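(* Let $\sigma \in S_n$ and let $P \in \mathrm{SYT}(\lambda)$ for some partition $\lambda$ of $n$. In the $q = t \rightarrow 1$ specialization of the $(q,t)$-Robinson--Schensted correspondence ($q\mathrm{RS}t$), the probability that $P$ is the insertion tableau of $\sigma$ is equal to $f_\lambda/n!$; that is, setting $q = t$ and letting $t \to 1$, $$\lim_{q = t \to 1}\ \sum_{Q \in \mathrm{SYT}(\lambda)} \mathcal{P}_{q\mathrm{RS}t}(\sigma \rightarrow P, Q) = \frac{f_\lambda}{n!}.$$
   Context: A partition $\kappa$ is identified with its Young diagram, the set of cells (row $r$, column $c$) with $r \geq 1$, $1 \le c \le \kappa_r$, drawn in French notation: row 1 (of length $\kappa_1$) is at the bottom, rows numbered bottom to top, columns left to right. $\mathrm{SYT}(\lambda)$ is the set of standard Young tableaux of shape $\lambda$ and $f_\lambda = |\mathrm{SYT}(\lambda)|$. Write $\mu \lessdot \lambda$ if $\mu \subseteq \lambda$ and $|\lambda/\mu| = 1$; $\mathcal{D}(\lambda) = \{\mu : \mu \lessdot \lambda\}$, $\mathcal{U}(\lambda) = \{\nu : \lambda \lessdot \nu\}$. For a cell $c \in \kappa$, $a_\kappa(c)$ (resp. $\ell_\kappa(c)$) is the number of cells of $\kappa$ strictly to the right of $c$ in its row (resp. strictly above $c$ in its column), and $$[h_\kappa(c)]^\ell = 1 - q^{a_\kappa(c)} t^{\ell_\kappa(c)+1}, \qquad [h_\kappa(c)]^a = 1 - q^{a_\kappa(c)+1} t^{\ell_\kappa(c)}.$$ For $\rho \lessdot \kappa$,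 let $\mathcal{R}_{\kappa/\rho}$ (resp. $\mathcal{C}_{\kappa/\rho}$) be the set of cells of $\rho$ in the same row (resp. column) as the cell $\kappa/\rho$, and $$\alpha_{\kappa/\rho} = \prod_{c \in \mathcal{R}_{\kappa/\rho}} \frac{[h_\rho(c)]^\ell}{[h_\kappa(c)]^\ell} \prod_{c \in \mathcal{C}_{\kappa/\rho}} \frac{[h_\rho(c)]^a}{[h_\kappa(c)]^a}.$$ For $\nu \in \mathcal{U}(\lambda)$ and $\mu \in \mathcal{D}(\lambda)$, let the cell $\nu/\lambda$ be in row $r_\nu$, column $c_\nu$, and the cell $\lambda/\mu$ in row $r_\mu$, column $c_\mu$. Define $$\mathcal{P}_\lambda(\lambda \rightarrow \nu) = t^{r_\nu-1}\alpha_{\nu/\lambda}, \qquad \mathcal{P}_\lambda(\mu \rightarrow \nu) = t^{r_\nu-r_\mu-1}\frac{\alpha_{\nu/\lambda}}{\alpha_{\lambda/\mu}} \cdot \frac{(1-q)(1-t)}{(1-q^{c_\mu-c_\nu}t^{r_\nu-r_\mu})(1-q^{c_\mu-c_\nu+1}t^{r_\nu-r_\mu-1})}.$$ These are regarded as (formal) probabilities: for each fixed $\mu \in \mathcal{D}(\lambda) \cup \{\lambda\}$ they sum to 1 over $\nu \in \mathcal{U}(\lambda)$. A partial standard Young tableau is a semistandard Young tableau with no repeated entries. For such $T$, $T^{(i)}$ denotes the shape of the subtableau of entries at most $i$. For a partial standard Young tableau $T$ and a number $k$ not an entry of $T$, the $(q,t)$-Robinson--Schensted insertion of $k$ into $T$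 is the probability distribution on partial standard Young tableaux computed as follows. (Initial insertion step) For each $\nu \in \mathcal{U}(T^{(k)})$, place $k$ in the cell $\nu/T^{(k)}$ with probability $\mathcal{P}_{T^{(k)}}(T^{(k)} \rightarrow \nu)$. If this cell is occupied in $T$ by an entry $k' > k$, then $k'$ is displaced; otherwise the process terminates. (Bumping steps) If an entry $z$ of $T$ is displaced by a smaller number, then for each $\nu \in \mathcal{U}(T^{(z)})$, place $z$ in the cell $\nu/T^{(z)}$ with probability $\mathcal{P}_{T^{(z)}}(T^{(z-1)} \rightarrow \nu)$ (here $T$ is always the original tableau before the insertion of $k$, and $T^{(z-1)}$ is the shape of its entries smaller than $z$). If this cell is occupied in $T$ by an entry $z' > z$, then $z'$ is displaced and this step is repeated for $z'$; otherwise the process terminates. The probability of an outcome $T'$ is the sum, over all insertion paths producing $T'$, of the products of the probabilities of their steps. For $\sigma = \sigma_1 \cdots \sigma_n \in S_n$ (one-line notation), $\mathcal{P}_{q\mathrm{RS}t}(\sigma \rightarrow P,Q)$ is the sum of the probabilities of all ways of successively inserting $\sigma_1, \ldots, \sigma_n$ by this procedure, starting from the empty tableau, such that the final tableau is $P$ (the insertion tableau) and the growth is recorded by $Q$ (the recording tableau), i.e., $Q^{(i)}$ is the shape of the tableau after the $i$-th insertion for each $i$. *)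

theory Defs
  imports Complex_Main "HOL-Combinatorics.Permutations"
begin

section \<open>Partitions and Young diagrams\<close>

text \<open>Cells are pairs (row, column), both counted from 1.  Rows are numbered from the bottom
  (French notation), so "above" means "in a row of larger index".\<close>

type_synonym cell = "nat \<times> nat"

definition partition :: "nat list \<Rightarrow> bool" where
  "partition \<kappa> \<longleftrightarrow> sorted_wrt (\<ge>) \<kappa> \<and> (\<forall>p\<in>set \<kappa>. p \<ge> 1)"

definition diagram :: "nat list \<Rightarrow> cell set" where
  "diagram \<kappa> = {(r, c). 1 \<le> r \<and> r \<le> length \<kappa> \<and> 1 \<le> c \<and> c \<le> \<kappa> ! (r - 1)}"

text \<open>From here on a partition is identified with its diagram.\<close>

definition young :: "cell set \<Rightarrow> bool" where
  "young D \<longleftrightarrow> (\<exists>\<kappa>. partition \<kappa> \<and> D = diagram \<kappa>)"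

definition covered_by :: "cell set \<Rightarrow> cell set \<Rightarrow> bool"  (infix "\<lessdot>" 50) where
  "\<mu> \<lessdot> lam \<longleftrightarrow> young \<mu> \<and> young lam \<and> \<mu> \<subseteq> lam \<and> card (lam - \<mu>) = 1"

definition up :: "cell set \<Rightarrow> cell set set" where
  "up lam = {\<nu>. lam \<lessdot> \<nu>}"

text \<open>The unique cell of \<open>\<kappa>/\<rho>\<close>; only meaningful when \<open>\<rho> \<lessdot> \<kappa>\<close>.\<close>

definition new_cell :: "cell set \<Rightarrow> cell set \<Rightarrow> cell" where
  "new_cell \<kappa> \<rho> = the_elem (\<kappa> - \<rho>)"

definition arm :: "cell set \<Rightarrow> cell \<Rightarrow> nat" where
  "arm \<kappa> u = card {c. c > snd u \<and> (fst u, c) \<in> \<kappa>}"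

definition leg :: "cell set \<Rightarrow> cell \<Rightarrow> nat" where
  "leg \<kappa> u = card {r. r > fst u \<and> (r, snd u) \<in> \<kappa>}"


section \<open>The transition weights\<close>

text \<open>The parameters \<open>q\<close> and \<open>t\<close> range over an arbitrary field, so that the definitions
  make sense both for indeterminates and for numbers.  Since the weights are formal
  (possibly negative, or not real numbers at all), they are plain field elements.\<close>

definition hook_leg :: "'a::field \<Rightarrow> 'a \<Rightarrow> cell set \<Rightarrow> cell \<Rightarrow> 'a" where
  "hook_leg q t \<kappa> u = 1 - q ^ arm \<kappa> u * t ^ (leg \<kappa> u + 1)"

definition hook_arm :: "'a::field \<Rightarrow> 'a \<Rightarrow> cell set \<Rightarrow> cell \<Rightarrow> 'a" where
  "hook_arm q t \<kappa> u = 1 - q ^ (arm \<kappa> u + 1) * t ^ leg \<kappa> u"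

definition row_cells :: "cell set \<Rightarrow> cell set \<Rightarrow> cell set" where
  "row_cells \<kappa> \<rho> = {u \<in> \<rho>. fst u = fst (new_cell \<kappa> \<rho>)}"

definition col_cells :: "cell set \<Rightarrow> cell set \<Rightarrow> cell set" where
  "col_cells \<kappa> \<rho> = {u \<in> \<rho>. snd u = snd (new_cell \<kappa> \<rho>)}"

definition alpha :: "'a::field \<Rightarrow> 'a \<Rightarrow> cell set \<Rightarrow> cell set \<Rightarrow> 'a" where
  "alpha q t \<kappa> \<rho> =
     (\<Prod>u\<in>row_cells \<kappa> \<rho>. hook_leg q t \<rho> u / hook_leg q t \<kappa> u) *
     (\<Prod>u\<in>col_cells \<kappa> \<rho>. hook_arm q t \<rho> u / hook_arm q t \<kappa> u)"

text \<open>\<open>trans_prob q t lam \<mu> \<nu>\<close> is \<open>\<P>\<^bsub>lam\<^esub>(\<mu> \<rightarrow> \<nu>)\<close>, for \<open>\<nu> \<in> up lam\<close> and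
  \<open>\<mu> = lam\<close> (first branch) or \<open>\<mu> \<lessdot> lam\<close> (second branch).  Exponents can be negative.\<close>

definition trans_prob ::
    "'a::field \<Rightarrow> 'a \<Rightarrow> cell set \<Rightarrow> cell set \<Rightarrow> cell set \<Rightarrow> 'a" where
  "trans_prob q t lam \<mu> \<nu> =
     (let r\<^sub>\<nu> = int (fst (new_cell \<nu> lam)); c\<^sub>\<nu> = int (snd (new_cell \<nu> lam));
          r\<^sub>\<mu> = int (fst (new_cell lam \<mu>)); c\<^sub>\<mu> = int (snd (new_cell lam \<mu>))
      in if \<mu> = lam then t powi (r\<^sub>\<nu> - 1) * alpha q t \<nu> lam
         else t powi (r\<^sub>\<nu> - r\<^sub>\<mu> - 1) * (alpha q t \<nu> lam / alpha q t lam \<mu>) *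
              ((1 - q) * (1 - t) /
               ((1 - q powi (c\<^sub>\<mu> - c\<^sub>\<nu>) * t powi (r\<^sub>\<nu> - r\<^sub>\<mu>)) *
                (1 - q powi (c\<^sub>\<mu> - c\<^sub>\<nu> + 1) * t powi (r\<^sub>\<nu> - r\<^sub>\<mu> - 1)))))"


section \<open>Tableaux\<close>

text \<open>A tableau is a partial map from cells to entries; its shape is its domain.\<close>

type_synonym tableau = "cell \<rightharpoonup> nat"

definition semistandard :: "tableau \<Rightarrow> bool" where
  "semistandard T \<longleftrightarrow> young (dom T) \<and> 0 \<notin> ran T \<and>
     (\<forall>r c c' x y. c < c' \<and> T (r, c) = Some x \<and> T (r, c') = Some y \<longrightarrow> x \<le> y) \<and>
     (\<forall>r r' c x y. r < r' \<and> T (r, c) = Some x \<and> T (r', c) = Some y \<longrightarrow> x < y)"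

definition partial_standard :: "tableau \<Rightarrow> bool" where
  "partial_standard T \<longleftrightarrow> semistandard T \<and> inj_on T (dom T)"

definition SYT :: "cell set \<Rightarrow> tableau set" where
  "SYT lam = {T. partial_standard T \<and> dom T = lam \<and> ran T = {1..card lam}}"

definition num_SYT :: "cell set \<Rightarrow> nat" where
  "num_SYT lam = card (SYT lam)"

text \<open>\<open>shape_upto T i\<close> is \<open>T\<^sup>(\<^sup>i\<^sup>)\<close>.\<close>

definition shape_upto :: "tableau \<Rightarrow> nat \<Rightarrow> cell set" where
  "shape_upto T i = {u. \<exists>x. T u = Some x \<and> x \<le> i}"


section \<open>Insertion\<close>

text \<open>An insertion path is recorded by the list of the partitions \<open>\<nu>\<close> chosen in its
  successive steps.  In the three functions below \<open>T\<close> is always the original tableau and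
  \<open>z\<close> is the number to be placed.  The cell of \<open>\<nu>/T\<^sup>(\<^sup>z\<^sup>)\<close> lies outside \<open>T\<^sup>(\<^sup>z\<^sup>)\<close>, so an
  entry of \<open>T\<close> found there is automatically larger than \<open>z\<close>.\<close>

fun ins_path :: "tableau \<Rightarrow> nat \<Rightarrow> cell set list \<Rightarrow> bool" where
  "ins_path T z [] = False"
| "ins_path T z (\<nu> # \<nu>s) =
     (\<nu> \<in> up (shape_upto T z) \<and>
      (case T (new_cell \<nu> (shape_upto T z)) of
         None \<Rightarrow> \<nu>s = []
       | Some z' \<Rightarrow> ins_path T z' \<nu>s))"

text \<open>The extra argument \<open>\<mu>\<close> is the source partition of the current step:
  \<open>T\<^sup>(\<^sup>k\<^sup>)\<close> in the initial step, and \<open>T\<^sup>(\<^sup>z\<^sup>-\<^sup>1\<^sup>)\<close> when \<open>z\<close> has been displaced.\<close>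

fun path_prob ::
    "'a::field \<Rightarrow> 'a \<Rightarrow> tableau \<Rightarrow> cell set \<Rightarrow> nat \<Rightarrow> cell set list \<Rightarrow> 'a" where
  "path_prob q t T \<mu> z [] = 1"
| "path_prob q t T \<mu> z (\<nu> # \<nu>s) =
     trans_prob q t (shape_upto T z) \<mu> \<nu> *
     (case T (new_cell \<nu> (shape_upto T z)) of
        None \<Rightarrow> 1
      | Some z' \<Rightarrow> path_prob q t T (shape_upto T (z' - 1)) z' \<nu>s)"

text \<open>The accumulator \<open>S\<close> is the tableau under construction.\<close>

fun path_result :: "tableau \<Rightarrow> tableau \<Rightarrow> nat \<Rightarrow> cell set list \<Rightarrow> tableau" where
  "path_result T S z [] = S"
| "path_result T S z (\<nu> # \<nu>s) =
     (let u = new_cell \<nu> (shape_upto T z); S' = S(u \<mapsto> z)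
      in case T u of None \<Rightarrow> S' | Some z' \<Rightarrow> path_result T S' z' \<nu>s)"

definition outcomes :: "tableau \<Rightarrow> nat \<Rightarrow> tableau set" where
  "outcomes T k = path_result T T k ` {\<nu>s. ins_path T k \<nu>s}"

definition insert_prob :: "'a::field \<Rightarrow> 'a \<Rightarrow> tableau \<Rightarrow> nat \<Rightarrow> tableau \<Rightarrow> 'a" where
  "insert_prob q t T k T' =
     (\<Sum>\<nu>s | ins_path T k \<nu>s \<and> path_result T T k \<nu>s = T'.
        path_prob q t T (shape_upto T k) k \<nu>s)"


section \<open>The (q,t)-Robinson--Schensted correspondence\<close>

text \<open>All possible sequences of tableaux \<open>T\<^sub>0 = \<emptyset>, T\<^sub>1, \<dots>, T\<^sub>n\<close> arising from
  successive insertion of the letters of a word.\<close>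

definition histories :: "nat list \<Rightarrow> tableau list set" where
  "histories w = {Ts. length Ts = length w + 1 \<and> Ts ! 0 = Map.empty \<and>
     (\<forall>i<length w. Ts ! Suc i \<in> outcomes (Ts ! i) (w ! i))}"

definition qRSt_prob :: "'a::field \<Rightarrow> 'a \<Rightarrow> nat list \<Rightarrow> tableau \<Rightarrow> tableau \<Rightarrow> 'a" where
  "qRSt_prob q t w P Q =
     (\<Sum>Ts | Ts \<in> histories w \<and> Ts ! length w = P \<and>
            (\<forall>i\<le>length w. dom (Ts ! i) = shape_upto Q i).
        \<Prod>i<length w. insert_prob q t (Ts ! i) (w ! i) (Ts ! Suc i))"

definition one_line :: "nat \<Rightarrow> (nat \<Rightarrow> nat) \<Rightarrow> nat list" where
  "one_line n \<sigma> = map \<sigma> [1..<Suc n]"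

end

theory Submission
  imports Defs
begin

text \<open>The hook length formula says that \<open>f\<^sub>\<lambda> / n!\<close> is \<open>g \<lambda> = (\<Prod>u\<in>\<lambda>. 1 / h\<^sub>\<lambda>(u))\<close>, which is
the constant \<open>inv_hooks\<close> below.  At \<open>q = t\<close> every factor \<open>1 - q\<^sup>at\<^sup>b\<close> in the transition weights
is \<open>1 - t\<^sup>h\<close> with \<open>h\<close> a hook length (or a difference of contents), so in the limit \<open>t \<rightarrow> 1\<close>

  \<^item> \<open>P(\<lambda> \<rightarrow> \<nu>) = g(\<nu>) / g(\<lambda>)\<close>,
  \<^item> \<open>P(\<mu> \<rightarrow> \<nu>) = (g(\<nu>) / g(\<lambda>)) / (g(\<lambda>) / g(\<mu>)) / d\<^sup>2\<close>,

where \<open>d\<close> is the difference of the contents of \<open>\<nu>/\<lambda>\<close> and \<open>\<lambda>/\<mu>\<close>.  This \<open>d\<close> is never zero.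

Claim: after inserting any word with distinct positive letters, in whatever order, a tableau \<open>T\<close> on
these letters has the limiting probability \<open>g(shape of T)\<close>.  The claim gives the theorem, since the sum over the
recording tableaux \<open>Q\<close> just forgets the growth of the shapes (\<open>sum_qRSt_prob\<close>).  The claim is
proved by induction on the word, and its induction step is the statement that the insertion of one
letter \<open>k\<close> carries the weight \<open>T \<mapsto> g(shape of T)\<close> on the tableaux with entry set \<open>A\<close> to the same
weight on the tableaux with entry set \<open>A \<union> {k}\<close> (\<open>insertion_balance\<close>).

That step is an induction on the largest entry.  If \<open>k\<close> is the largest letter, it is placed at the
border, and \<open>g(\<lambda>) P(\<lambda> \<rightarrow> \<nu>) = g(\<nu>)\<close>.  Otherwise let \<open>m > k\<close> be the largest entry, at the cell
\<open>x\<close> of \<open>T\<close>, and let \<open>T\<^sub>0\<close> be \<open>T\<close> without \<open>m\<close>.  Inserting \<open>k\<close> into \<open>T\<close> runs exactly like inserting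
\<open>k\<close> into \<open>T\<^sub>0\<close>; only if that insertion ends in the cell \<open>x\<close> is \<open>m\<close> displaced, and it then takes one
more step (\<open>branch_sum_extend\<close>).  Summing over the possible positions of \<open>x\<close>, with the shapes \<open>\<mu>\<close>
before and \<open>\<lambda>\<close> after the insertion into \<open>T\<^sub>0\<close> and the final shape \<open>\<nu>\<close> fixed, leaves an identity that
involves only the three shapes \<open>\<mu> \<lessdot> \<lambda> \<lessdot> \<nu>\<close> (\<open>local_balance\<close>):


  \<^item> \<open>(g(\<nu>) / g(\<lambda>)) / d\<^sup>2 + g(\<kappa>) / g(\<mu>) = g(\<nu>) / g(\<lambda>)\<close>, where \<open>\<kappa> = \<mu> \<union> (\<nu>/\<lambda>)\<close> and the second summand
    is dropped if \<open>\<kappa>\<close> is not a shape.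

The reason is that filling the cell \<open>\<nu>/\<lambda>\<close> multiplies \<open>g\<close> by nearly the same factor whether \<open>\<lambda>/\<mu>\<close> is
filled or not: only the cell where the row of one of them meets the column of the other makes a
difference.  This gives \<open>g(\<kappa>) g(\<lambda>) = g(\<mu>) g(\<nu>) (1 - 1/d\<^sup>2)\<close> (\<open>inv_hooks_two_addable\<close>), and if \<open>\<kappa>\<close> is not a shape, the two
cells are adjacent and \<open>d\<^sup>2 = 1\<close>.

The hook length formula itself follows from \<open>\<Sum>\<^sub>\<mu> g(\<mu>) = |\<lambda>| g(\<lambda>)\<close>, the sum being over \<open>\<mu> \<lessdot> \<lambda>\<close>.  This is
the Greene--Nijenhuis--Wilf hook walk, carried out here with the explicit product formula for the
probability that the walk ends in a given corner.\<close>

section \<open>Young diagrams and hook lengths\<close>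

lemma initial_interval:
  assumes "finite S" "0 \<notin> S" "\<And>c c'. c \<in> S \<Longrightarrow> 1 \<le> c' \<Longrightarrow> c' \<le> c \<Longrightarrow> c' \<in> S"
  shows "S = {1..card S}"
proof (cases "S = {}")
  case False
  have "S = {1..Max S}"
  proof
    show "S \<subseteq> {1..Max S}"
      using assms(1,2) by (auto simp: Suc_le_eq) (metis gr0I)
    show "{1..Max S} \<subseteq> S"
      using assms(3)[OF Max_in[OF assms(1) False]] by auto
  qed
  then obtain m where "S = {1..m}" ..
  then show ?thesis by simp
qed simp

definition rowlen :: "cell set \<Rightarrow> nat \<Rightarrow> nat" where
  "rowlen D r = card {c. (r, c) \<in> D}"

definition collen :: "cell set \<Rightarrow> nat \<Rightarrow> nat" where
  "collen D c = card {r. (r, c) \<in> D}"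

text \<open>Partitions as lists are inconvenient for adding and removing cells, so shapes are handled as finite
order ideals of positive pairs; \<open>young_iff_lower_set\<close> shows that these are the same objects.\<close>

definition lower_set :: "cell set \<Rightarrow> bool" where
  "lower_set D \<longleftrightarrow> finite D \<and> (\<forall>r c. (r, c) \<in> D \<longrightarrow> 1 \<le> r \<and> 1 \<le> c) \<and>
     (\<forall>r c r' c'. (r, c) \<in> D \<longrightarrow> 1 \<le> r' \<longrightarrow> r' \<le> r \<longrightarrow> 1 \<le> c' \<longrightarrow> c' \<le> c \<longrightarrow> (r', c') \<in> D)"

lemma lower_set_finite: "lower_set D \<Longrightarrow> finite D"
  and lower_set_pos: "lower_set D \<Longrightarrow> (r, c) \<in> D \<Longrightarrow> 1 \<le> r \<and> 1 \<le> c"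
  and lower_setD: "lower_set D \<Longrightarrow> (r, c) \<in> D \<Longrightarrow> 1 \<le> r' \<Longrightarrow> r' \<le> r \<Longrightarrow> 1 \<le> c' \<Longrightarrow> c' \<le> c
    \<Longrightarrow> (r', c') \<in> D"
  unfolding lower_set_def by blast+

lemma lower_set_finite_row: "lower_set D \<Longrightarrow> finite {c. (r, c) \<in> D}"
  by (rule finite_subset[of _ "snd ` D"]) (force dest: lower_set_finite)+

lemma lower_set_finite_col: "lower_set D \<Longrightarrow> finite {r. (r, c) \<in> D}"
  by (rule finite_subset[of _ "fst ` D"]) (force dest: lower_set_finite)+

lemma in_row_iff:
  assumes "lower_set D" shows "(r, c) \<in> D \<longleftrightarrow> 1 \<le> c \<and> c \<le> rowlen D r"
proof -
  have "{c. (r, c) \<in> D} = {1..card {c. (r, c) \<in> D}}"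
  proof (rule initial_interval)
    show "finite {c. (r, c) \<in> D}" by (rule lower_set_finite_row[OF assms])
    show "0 \<notin> {c. (r, c) \<in> D}" using lower_set_pos[OF assms] by fastforce
    fix x y
    assume "x \<in> {c. (r, c) \<in> D}" "1 \<le> y" "y \<le> x"
    then show "y \<in> {c. (r, c) \<in> D}"
      using lower_setD[OF assms, of r x r y] lower_set_pos[OF assms, of r x] by simp
  qed
  then show ?thesis unfolding rowlen_def by (metis (mono_tags) atLeastAtMost_iff mem_Collect_eq)
qed

lemma in_col_iff:
  assumes "lower_set D" shows "(r, c) \<in> D \<longleftrightarrow> 1 \<le> r \<and> r \<le> collen D c"
proof -
  have "{r. (r, c) \<in> D} = {1..card {r. (r, c) \<in> D}}"
  proof (rule initial_interval)
    show "finite {r. (r, c) \<in> D}" by (rule lower_set_finite_col[OF assms])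
    show "0 \<notin> {r. (r, c) \<in> D}" using lower_set_pos[OF assms] by fastforce
    fix x y
    assume "x \<in> {r. (r, c) \<in> D}" "1 \<le> y" "y \<le> x"
    then show "y \<in> {r. (r, c) \<in> D}"
      using lower_setD[OF assms, of x c y c] lower_set_pos[OF assms, of x c] by simp
  qed
  then show ?thesis unfolding collen_def by (metis (mono_tags) atLeastAtMost_iff mem_Collect_eq)
qed

lemma lower_set_diagram:
  assumes "partition \<kappa>" shows "lower_set (diagram \<kappa>)"
proof -
  have "diagram \<kappa> = Sigma {1..length \<kappa>} (\<lambda>r. {1..\<kappa> ! (r - 1)})"
    by (auto simp: diagram_def)
  then have "finite (diagram \<kappa>)" by simp
  moreover have "\<kappa> ! (r - 1) \<le> \<kappa> ! (r' - 1)"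
    if "1 \<le> r'" "r' \<le> r" "r \<le> length \<kappa>" for r r'
  proof (cases "r' = r")
    case False
    then have "r' - 1 < r - 1" "r - 1 < length \<kappa>" using that by auto
    then show ?thesis using assms sorted_wrt_nth_less[of "(\<ge>)" \<kappa> "r' - 1" "r - 1"]
      by (auto simp: partition_def)
  qed simp
  ultimately show ?thesis
    unfolding lower_set_def diagram_def by (fastforce intro: order_trans)
qed

lemma young_iff_lower_set: "young D \<longleftrightarrow> lower_set D"
proof
  show "young D \<Longrightarrow> lower_set D" by (auto simp: young_def lower_set_diagram)
  assume D: "lower_set D"
  define L where "L = collen D 1"
  define \<kappa> where "\<kappa> = map (rowlen D) [1..<Suc L]"
  have len: "length \<kappa> = L" by (simp add: \<kappa>_def)
  have nth: "\<kappa> ! (r - 1) = rowlen D r" if "1 \<le> r" "r \<le> L" for r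
    using that by (simp add: \<kappa>_def del: upt_Suc)
  have "D = diagram \<kappa>"
  proof (intro set_eqI, clarify)
    fix r c
    have "(r, c) \<in> D \<Longrightarrow> 1 \<le> r \<and> r \<le> L"
      using lower_setD[OF D, of r c r 1] lower_set_pos[OF D, of r c] in_col_iff[OF D, of r 1]
      by (auto simp: L_def)
    then show "(r, c) \<in> D \<longleftrightarrow> (r, c) \<in> diagram \<kappa>"
      using nth[of r] in_row_iff[OF D, of r c] by (auto simp: diagram_def len)
  qed
  moreover have "partition \<kappa>"
  proof -
    have "rowlen D r' \<le> rowlen D r" if "1 \<le> r" "r \<le> r'" for r r'
    proof (cases "rowlen D r' = 0")
      case False
      then have "(r', rowlen D r') \<in> D" using in_row_iff[OF D] by simp
      then have "(r, rowlen D r') \<in> D" using that False by (auto intro: lower_setD[OF D])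
      then show ?thesis using in_row_iff[OF D] by simp
    qed simp
    moreover have "rowlen D r \<ge> 1" if "1 \<le> r" "r \<le> L" for r
      using that in_col_iff[OF D, of r 1] in_row_iff[OF D, of r 1] by (simp add: L_def)
    ultimately show ?thesis
      by (auto simp: partition_def \<kappa>_def sorted_wrt_map sorted_wrt_iff_nth_less simp del: upt_Suc)
  qed
  ultimately show "young D" by (auto simp: young_def)
qed

definition addable :: "cell set \<Rightarrow> cell \<Rightarrow> bool" where
  "addable D x \<longleftrightarrow> lower_set D \<and> x \<notin> D \<and> lower_set (insert x D)"

lemma covered_by_iff: "D \<lessdot> E \<longleftrightarrow> (\<exists>x. addable D x \<and> E = insert x D)"
proof
  assume *: "D \<lessdot> E"
  then obtain x where "E - D = {x}" by (auto simp: covered_by_def card_1_singleton_iff)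
  then have "E = insert x D" "x \<notin> D" using * by (auto simp: covered_by_def)
  then show "\<exists>x. addable D x \<and> E = insert x D"
    using * by (intro exI[of _ x]) (simp add: covered_by_def addable_def young_iff_lower_set)
next
  assume "\<exists>x. addable D x \<and> E = insert x D"
  then obtain x where "addable D x" "E = insert x D" by blast
  moreover from this have "E - D = {x}" by (auto simp: addable_def)
  ultimately show "D \<lessdot> E" by (auto simp: covered_by_def addable_def young_iff_lower_set)
qed

lemma covered_by_insert: "addable D x \<Longrightarrow> D \<lessdot> insert x D"
  unfolding covered_by_iff by blast

lemma up_eq: "up D = (\<lambda>x. insert x D) ` {x. addable D x}"
  by (auto simp: up_def covered_by_iff)

lemma new_cell_insert [simp]: "x \<notin> D \<Longrightarrow> new_cell (insert x D) D = x"
  by (simp add: new_cell_def insert_Diff_if)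

lemma addable_notin: "addable D x \<Longrightarrow> x \<notin> D"
  by (simp add: addable_def)

lemma inj_on_insert_addable: "inj_on (\<lambda>x. insert x D) {x. addable D x}"
  by (auto simp: inj_on_def addable_def)

lemma addable_iff:
  "addable D (r, c) \<longleftrightarrow> lower_set D \<and> (r, c) \<notin> D \<and> 1 \<le> r \<and> 1 \<le> c \<and>
     (r = 1 \<or> (r - 1, c) \<in> D) \<and> (c = 1 \<or> (r, c - 1) \<in> D)"
proof
  assume A: "addable D (r, c)"
  then have D: "lower_set D" "(r, c) \<notin> D" "lower_set (insert (r, c) D)" by (auto simp: addable_def)
  have "1 \<le> r \<and> 1 \<le> c" using lower_set_pos[OF D(3)] by blast
  moreover have "(r - 1, c) \<in> D" if "r \<noteq> 1"
    using lower_setD[OF D(3), of r c "r - 1" c] that calculation by force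
  moreover have "(r, c - 1) \<in> D" if "c \<noteq> 1"
    using lower_setD[OF D(3), of r c r "c - 1"] that calculation by force
  ultimately show "lower_set D \<and> (r, c) \<notin> D \<and> 1 \<le> r \<and> 1 \<le> c \<and>
     (r = 1 \<or> (r - 1, c) \<in> D) \<and> (c = 1 \<or> (r, c - 1) \<in> D)" using D by blast
next
  assume A: "lower_set D \<and> (r, c) \<notin> D \<and> 1 \<le> r \<and> 1 \<le> c \<and>
     (r = 1 \<or> (r - 1, c) \<in> D) \<and> (c = 1 \<or> (r, c - 1) \<in> D)"
  then have D: "lower_set D" by blast
  have step: "(r', c') \<in> insert (r, c) D" if "1 \<le> r'" "r' \<le> r" "1 \<le> c'" "c' \<le> c" for r' c'
  proof (cases "r' = r")
    case True
    then show ?thesis using that A lower_setD[OF D, of r "c - 1" r c'] by (cases "c' = c") auto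
  next
    case False
    then show ?thesis using that A lower_setD[OF D, of "r - 1" c r' c'] by auto
  qed
  have "lower_set (insert (r, c) D)"
    unfolding lower_set_def
  proof (intro conjI allI impI)
    show "finite (insert (r, c) D)" using lower_set_finite[OF D] by simp
    show "1 \<le> r'" "1 \<le> c'" if "(r', c') \<in> insert (r, c) D" for r' c'
      using that A lower_set_pos[OF D, of r' c'] by auto
    show "(r'', c'') \<in> insert (r, c) D"
      if "(r', c') \<in> insert (r, c) D" "1 \<le> r''" "r'' \<le> r'" "1 \<le> c''" "c'' \<le> c'" for r' c' r'' c''
    proof (cases "(r', c') = (r, c)")
      case True
      then show ?thesis using step that by simp
    next
      case False
      then show ?thesis using that lower_setD[OF D, of r' c' r'' c''] by auto
    qed
  qed
  then show "addable D (r, c)" using A by (simp add: addable_def)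
qed

lemma addable_mono: "addable D x \<Longrightarrow> D \<subseteq> E \<Longrightarrow> lower_set E \<Longrightarrow> x \<notin> E \<Longrightarrow> addable E x"
  by (cases x) (auto simp: addable_iff)

lemma addable_row: "addable D (a, b) \<Longrightarrow> (a, c) \<in> D \<longleftrightarrow> 1 \<le> c \<and> c < b"
proof -
  assume A: "addable D (a, b)"
  then have D: "lower_set D" and I: "lower_set (insert (a, b) D)" by (auto simp: addable_def)
  show ?thesis
  proof
    assume c: "(a, c) \<in> D"
    have "1 \<le> a" "1 \<le> b" using lower_set_pos[OF I] by auto
    then have "\<not> b \<le> c" using lower_setD[OF D c, of a b] A by (auto simp: addable_def)
    then show "1 \<le> c \<and> c < b" using lower_set_pos[OF D c] by simp
  next
    assume "1 \<le> c \<and> c < b"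
    then show "(a, c) \<in> D" using lower_setD[OF I, of a b a c] lower_set_pos[OF I, of a b] by auto
  qed
qed

lemma addable_col: "addable D (a, b) \<Longrightarrow> (r, b) \<in> D \<longleftrightarrow> 1 \<le> r \<and> r < a"
proof -
  assume A: "addable D (a, b)"
  then have D: "lower_set D" and I: "lower_set (insert (a, b) D)" by (auto simp: addable_def)
  show ?thesis
  proof
    assume c: "(r, b) \<in> D"
    have "1 \<le> a" "1 \<le> b" using lower_set_pos[OF I] by auto
    then have "\<not> a \<le> r" using lower_setD[OF D c, of a b] A by (auto simp: addable_def)
    then show "1 \<le> r \<and> r < a" using lower_set_pos[OF D c] by simp
  next
    assume "1 \<le> r \<and> r < a"
    then show "(r, b) \<in> D" using lower_setD[OF I, of a b r b] lower_set_pos[OF I, of a b] by auto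
  qed
qed

lemma addable_pos: "addable D (a, b) \<Longrightarrow> 1 \<le> a \<and> 1 \<le> b"
  by (simp add: addable_iff)

lemma arm_insert:
  assumes "addable D (a, b)"
  shows "arm (insert (a, b) D) (r, c) = arm D (r, c) + (if r = a \<and> c < b then 1 else 0)"
proof -
  have D: "lower_set D" using assms by (simp add: addable_def)
  have fin: "finite {c'. c < c' \<and> (r, c') \<in> D}"
    by (rule finite_subset[OF _ lower_set_finite_row[OF D, of r]]) auto
  have "{c'. c < c' \<and> (r, c') \<in> insert (a, b) D} =
        (if r = a \<and> c < b then insert b {c'. c < c' \<and> (r, c') \<in> D} else {c'. c < c' \<and> (r, c') \<in> D})"
    by auto
  note eq = this
  show ?thesis
    unfolding arm_def fst_conv snd_conv eq using fin addable_notin[OF assms] by auto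
qed

lemma leg_insert:
  assumes "addable D (a, b)"
  shows "leg (insert (a, b) D) (r, c) = leg D (r, c) + (if c = b \<and> r < a then 1 else 0)"
proof -
  have D: "lower_set D" using assms by (simp add: addable_def)
  have fin: "finite {r'. r < r' \<and> (r', c) \<in> D}"
    by (rule finite_subset[OF _ lower_set_finite_col[OF D, of c]]) auto
  have "{r'. r < r' \<and> (r', c) \<in> insert (a, b) D} =
        (if c = b \<and> r < a then insert a {r'. r < r' \<and> (r', c) \<in> D} else {r'. r < r' \<and> (r', c) \<in> D})"
    by auto
  note eq = this
  show ?thesis
    unfolding leg_def fst_conv snd_conv eq using fin addable_notin[OF assms] by auto
qed

lemma arm_eq: "lower_set D \<Longrightarrow> arm D (r, c) = rowlen D r - c"
proof -
  assume "lower_set D"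
  then have "{c'. c < c' \<and> (r, c') \<in> D} = {Suc c..rowlen D r}" by (auto simp: in_row_iff)
  then show ?thesis by (simp add: arm_def)
qed

lemma leg_eq: "lower_set D \<Longrightarrow> leg D (r, c) = collen D c - r"
proof -
  assume "lower_set D"
  then have "{r'. r < r' \<and> (r', c) \<in> D} = {Suc r..collen D c}" by (auto simp: in_col_iff)
  then show ?thesis by (simp add: leg_def)
qed

definition hooklen :: "cell set \<Rightarrow> cell \<Rightarrow> nat" where
  "hooklen D u = arm D u + leg D u + 1"

text \<open>By the hook length formula below this is \<open>f\<^sub>D / |D|!\<close>, the probability of a single standard tableau
of shape \<open>D\<close> in the claimed distribution.\<close>

definition inv_hooks :: "cell set \<Rightarrow> real" where
  "inv_hooks D = (\<Prod>u\<in>D. 1 / real (hooklen D u))"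

lemma hooklen_pos: "hooklen D u > 0"
  by (simp add: hooklen_def)

lemma hooklen_neq_0 [simp]: "hooklen D u \<noteq> 0"
  by (simp add: hooklen_def)

lemma inv_hooks_pos: "inv_hooks D > 0"
  by (simp add: inv_hooks_def hooklen_pos prod_pos)

lemma hooklen_insert:
  assumes "addable D x" "u \<in> D"
  shows "hooklen (insert x D) u = hooklen D u + (if fst u = fst x \<or> snd u = snd x then 1 else 0)"
proof -
  obtain a b r c where [simp]: "x = (a, b)" "u = (r, c)" by (metis surj_pair)
  show ?thesis
    using assms arm_insert[of D a b r c] leg_insert[of D a b r c]
      addable_row[of D a b c] addable_col[of D a b r] by (auto simp: hooklen_def)
qed

lemma hooklen_new:
  assumes "addable D x" shows "hooklen (insert x D) x = 1"
proof -
  obtain a b where [simp]: "x = (a, b)" by (metis surj_pair)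
  have "{c. b < c \<and> (a, c) \<in> D} = {}" "{r. a < r \<and> (r, b) \<in> D} = {}"
    using assms addable_row[of D a b] addable_col[of D a b] by auto
  then have "arm D x = 0" "leg D x = 0"
    using assms by (simp_all only: arm_def leg_def fst_conv snd_conv \<open>x = (a, b)\<close> card.empty)
  then show ?thesis using assms arm_insert[of D a b a b] leg_insert[of D a b a b]
    by (simp add: hooklen_def)
qed

lemma inv_hooks_insert:
  assumes "addable D x"
  shows "inv_hooks (insert x D) = inv_hooks D * (\<Prod>u\<in>D. real (hooklen D u) / real (hooklen (insert x D) u))"
proof -
  have "finite D" "x \<notin> D" using assms by (auto simp: addable_def lower_set_finite)
  then have "inv_hooks (insert x D) = (\<Prod>u\<in>D. 1 / real (hooklen (insert x D) u))"
    by (simp add: inv_hooks_def hooklen_new[OF assms])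
  also have "\<dots> = (\<Prod>u\<in>D. 1 / real (hooklen D u) * (real (hooklen D u) / real (hooklen (insert x D) u)))"
    by (rule prod.cong) simp_all
  finally show ?thesis by (simp only: inv_hooks_def[of D] prod.distrib)
qed

text \<open>Filling an addable cell lengthens only the hooks of the cells in its row and its column, and its own
hook has length 1.  The right-hand side is therefore the limit of \<open>\<alpha>\<close> at \<open>q = t \<rightarrow> 1\<close>.\<close>

lemma inv_hooks_ratio:
  assumes "addable D x"
  shows "inv_hooks (insert x D) / inv_hooks D =
    (\<Prod>u\<in>row_cells (insert x D) D. real (hooklen D u) / real (hooklen (insert x D) u)) *
    (\<Prod>u\<in>col_cells (insert x D) D. real (hooklen D u) / real (hooklen (insert x D) u))"
proof -
  let ?f = "\<lambda>u. real (hooklen D u) / real (hooklen (insert x D) u)"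
  let ?R = "row_cells (insert x D) D" and ?C = "col_cells (insert x D) D"
  have fin: "finite D" and x: "x \<notin> D" using assms by (auto simp: addable_def lower_set_finite)
  have R: "?R = {u \<in> D. fst u = fst x}" and C: "?C = {u \<in> D. snd u = snd x}"
    using x by (auto simp: row_cells_def col_cells_def)
  have disj: "?R \<inter> ?C = {}" using x by (auto simp: R C prod_eq_iff)
  have "prod ?f D = prod ?f (?R \<union> ?C)"
  proof (rule prod.mono_neutral_right[OF fin])
    show "?R \<union> ?C \<subseteq> D" by (auto simp: R C)
    show "\<forall>u\<in>D - (?R \<union> ?C). ?f u = 1"
      using hooklen_insert[OF assms] hooklen_pos by (auto simp: R C)
  qed
  also have "\<dots> = prod ?f ?R * prod ?f ?C"
    by (rule prod.union_disjoint) (use fin disj in \<open>auto simp: R C\<close>)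
  finally show ?thesis using inv_hooks_insert[OF assms] inv_hooks_pos[of D] by simp
qed

definition content :: "cell \<Rightarrow> int" where
  "content u = int (snd u) - int (fst u)"

text \<open>Two cells of equal content lie on one diagonal.  South-west of \<open>e\<close> everything is filled; if \<open>x\<close> were strictly north-east of \<open>e\<close> on it, the
cell below \<open>x\<close> would be present before \<open>e\<close> is and force \<open>e\<close> to be present as well.  This keeps the
denominators of the bumping weights away from zero in the limit.\<close>

lemma content_addable_neq_removable:
  assumes "addable D e" "addable (insert e D) x"
  shows "content x \<noteq> content e"
proof
  assume eq: "content x = content e"
  obtain a b a' b' where [simp]: "x = (a, b)" "e = (a', b')" by (metis surj_pair)
  have L: "lower_set D" "lower_set (insert e D)" using assms by (auto simp: addable_def)
  have pos: "1 \<le> a" "1 \<le> b" "1 \<le> a'" "1 \<le> b'"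
    using addable_pos[of D a' b'] addable_pos[of "insert e D" a b] assms by auto
  have "(a \<le> a' \<and> b \<le> b') \<or> (a' < a \<and> b' < b)" using eq by (simp add: content_def) linarith
  then consider "a \<le> a'" "b \<le> b'" | "a' < a" "b' < b" by blast
  then show False
  proof cases
    case 1
    then have "x \<in> insert e D" using lower_setD[OF L(2), of a' b' a b] pos by simp
    then show False using assms(2) by (simp add: addable_def)
  next
    case 2
    then have "(a - 1, b) \<in> insert e D"
      using assms(2) pos by (simp add: addable_iff)
    then have "(a - 1, b) \<in> D" using 2 by auto
    then have "e \<in> D" using lower_setD[OF L(1), of "a - 1" b a' b'] pos 2 by simp
    then show False using assms(1) by (simp add: addable_def)
  qed
qed

text \<open>Both products compare hook lengths before and after filling \<open>(a, b)\<close>, without and with \<open>(a', b')\<close>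
already filled.  The factors agree except at the cell \<open>(a, b')\<close>, the only one whose hook
is lengthened by both corners: its hook length \<open>h\<close> satisfies \<open>h + 1 = d\<close>, and the two factors are
\<open>h / (h + 1)\<close> and \<open>(h + 1) / (h + 2)\<close>, whose quotient is \<open>1 - 1 / d\<^sup>2\<close>.\<close>

lemma two_addable_products:
  assumes x: "addable D (a, b)" and y: "addable D (a', b')" and lt: "a < a'"
  defines "d \<equiv> real_of_int (content (a, b) - content (a', b'))"
  shows "(\<Prod>u\<in>D. real (hooklen D u) / real (hooklen (insert (a, b) D) u)) =
    (1 - 1 / d\<^sup>2) * (\<Prod>u\<in>D. real (hooklen (insert (a', b') D) u) /
       real (hooklen (insert (a, b) (insert (a', b') D)) u))"
    and "b' < b" and "addable (insert (a', b') D) (a, b)" "addable (insert (a, b) D) (a', b')"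
proof -
  have D: "lower_set D" "lower_set (insert (a, b) D)" "lower_set (insert (a', b') D)"
    "(a, b) \<notin> D" "(a', b') \<notin> D" 
    using x y by (auto simp: addable_def)
  have fin: "finite D" using D lower_set_finite by blast
  have p: "1 \<le> a" "1 \<le> b" "1 \<le> a'" "1 \<le> b'" using addable_pos x y by auto
  show bb: "b' < b"
  proof (rule ccontr)
    assume "\<not> b' < b"
    then have "(a, b) \<in> insert (a', b') D" using lower_setD[OF D(3), of a' b' a b] p lt by simp
    then show False using D lt by auto
  qed
  show y2: "addable (insert (a, b) D) (a', b')" using addable_mono[OF y _ D(2)] D lt by auto
  show x2: "addable (insert (a', b') D) (a, b)" using addable_mono[OF x _ D(3)] D lt by auto
  let ?f = "\<lambda>u. real (hooklen D u) / real (hooklen (insert (a, b) D) u)"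
  let ?g = "\<lambda>u. real (hooklen (insert (a', b') D) u) / real (hooklen (insert (a, b) (insert (a', b') D)) u)"
  \<comment> \<open>the cell where the row of \<open>(a, b)\<close> meets the column of \<open>(a', b')\<close>\<close>
  let ?p = "(a, b')"
  have pD: "?p \<in> D" using addable_row[OF x] p bb by simp
  have same: "?f u = ?g u" if "u \<in> D - {?p}" for u
    using that hooklen_insert[OF x, of u] hooklen_insert[OF y, of u] hooklen_insert[OF x2, of u]
      addable_row[OF x, of "snd u"] addable_row[OF y, of "snd u"] 
      addable_col[OF x, of "fst u"] addable_col[OF y, of "fst u"]
      hooklen_pos[of D u] lt bb
    by (cases u) (auto split: if_splits)
  have arm: "arm D ?p = b - 1 - b'"
  proof -
    have "{c. b' < c \<and> (a, c) \<in> D} = {Suc b'..<b}" by (auto simp: addable_row[OF x])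
    then show ?thesis by (simp add: arm_def)
  qed
  have leg: "leg D ?p = a' - 1 - a"
  proof -
    have "{r. a < r \<and> (r, b') \<in> D} = {Suc a..<a'}" by (auto simp: addable_col[OF y])
    then show ?thesis by (simp add: leg_def)
  qed
  have h: "real (hooklen D ?p) = d - 1"
    using lt bb by (simp add: hooklen_def arm leg d_def content_def of_nat_diff)
  have hx: "hooklen (insert (a, b) D) ?p = hooklen D ?p + 1"
    and hy: "hooklen (insert (a', b') D) ?p = hooklen D ?p + 1"
    and hxy: "hooklen (insert (a, b) (insert (a', b') D)) ?p = hooklen D ?p + 2"
    using hooklen_insert[OF x pD] hooklen_insert[OF y pD] hooklen_insert[OF x2, of ?p] pD by auto
  have d1: "d > 1" using h hooklen_pos[of D ?p] by linarith
  have "?f ?p = (1 - 1 / d\<^sup>2) * ?g ?p"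
  proof -
    have "d \<noteq> 0" "d + 1 \<noteq> 0" using d1 by auto
    then have "(d - 1) / d = (1 - 1 / d\<^sup>2) * (d / (d + 1))"
      by (simp add: divide_simps power2_eq_square) (simp add: algebra_simps)
    then show ?thesis by (simp add: hx hy hxy h add.commute)
  qed
  moreover have "prod ?f (D - {?p}) = prod ?g (D - {?p})"
    by (rule prod.cong) (use same in auto)
  ultimately show "prod ?f D = (1 - 1 / d\<^sup>2) * prod ?g D"
    by (simp add: prod.remove[OF fin pD])
qed

lemma inv_hooks_two_addable_ordered:
  assumes x: "addable D (a, b)" and y: "addable D (a', b')" and lt: "a < a'"
  shows "inv_hooks (insert (a, b) D) * inv_hooks (insert (a', b') D) =
    inv_hooks D * inv_hooks (insert (a, b) (insert (a', b') D)) *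
      (1 - 1 / (real_of_int (content (a, b) - content (a', b')))\<^sup>2)"
proof -
  note T = two_addable_products[OF x y lt]
  have fin: "finite D" and y': "(a', b') \<notin> D" using y by (auto simp: addable_def lower_set_finite)
  have "hooklen (insert (a, b) (insert (a', b') D)) (a', b') = hooklen (insert (a', b') D) (a', b')"
    using hooklen_insert[OF T(3), of "(a', b')"] lt T(2) by auto
  then show ?thesis
    using inv_hooks_insert[OF x] inv_hooks_insert[OF T(3)] T(1) hooklen_pos[of "insert (a', b') D" "(a', b')"]
    by (simp add: fin y')
qed

text \<open>Distinct addable cells lie in different rows, and the identity is symmetric in them, so the ordered
case suffices.\<close>

lemma inv_hooks_two_addable:
  assumes x: "addable D x" and y: "addable D y" and neq: "x \<noteq> y"
  shows "inv_hooks (insert x D) * inv_hooks (insert y D) =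
    inv_hooks D * inv_hooks (insert x (insert y D)) *
      (1 - 1 / (real_of_int (content x - content y))\<^sup>2)"
    and "addable (insert y D) x"
proof -
  obtain a b a' b' where [simp]: "x = (a, b)" "y = (a', b')" by (metis surj_pair)
  have "a \<noteq> a'"
  proof
    assume [simp]: "a = a'"
    have "b \<noteq> b'" using neq by simp
    then show False
      using addable_row[of D a b b'] addable_row[of D a' b' b] x y
        addable_pos[of D a b] addable_pos[of D a' b'] addable_notin[OF x] addable_notin[OF y]
      by (cases "b < b'") auto
  qed
  then consider "a < a'" | "a' < a" by linarith
  then have "inv_hooks (insert x D) * inv_hooks (insert y D) =
    inv_hooks D * inv_hooks (insert x (insert y D)) *
      (1 - 1 / (real_of_int (content x - content y))\<^sup>2) \<and> addable (insert y D) x"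
  proof cases
    case 1
    then show ?thesis
      using inv_hooks_two_addable_ordered[of D a b a' b'] two_addable_products(3)[of D a b a' b'] x y
      by simp
  next
    case 2
    have "(real_of_int (content x - content y))\<^sup>2 = (real_of_int (content y - content x))\<^sup>2"
      by (simp add: power2_commute)
    then show ?thesis
      using inv_hooks_two_addable_ordered[of D a' b' a b] two_addable_products(4)[of D a' b' a b] x y 2
      by (simp add: insert_commute mult.commute)
  qed
  then show "inv_hooks (insert x D) * inv_hooks (insert y D) =
    inv_hooks D * inv_hooks (insert x (insert y D)) *
      (1 - 1 / (real_of_int (content x - content y))\<^sup>2)" "addable (insert y D) x" by auto
qed

text \<open>If filling \<open>e\<close> is what makes \<open>x\<close> addable, then \<open>x\<close> is the right or the upper neighbour of \<open>e\<close>.\<close>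

lemma content_not_addable:
  assumes "addable D e" "addable (insert e D) x" "\<not> addable D x"
  shows "(real_of_int (content x - content e))\<^sup>2 = 1"
proof -
  obtain a b a' b' where [simp]: "x = (a, b)" "e = (a', b')" by (metis surj_pair)
  have "(a' = a - 1 \<and> a \<ge> 1 \<and> b' = b) \<or> (a' = a \<and> b' = b - 1 \<and> b \<ge> 1)"
    using assms by (auto simp: addable_iff)
  then have "content x - content e = 1 \<or> content x - content e = - 1"
    by (auto simp: content_def)
  then have "(content x - content e)\<^sup>2 = 1" by (auto simp del: \<open>x = (a, b)\<close> \<open>e = (a', b')\<close>)
  then show ?thesis by (metis of_int_1 of_int_power)
qed

section \<open>Hook walks\<close>

definition removable :: "cell set \<Rightarrow> cell \<Rightarrow> bool" where
  "removable D e \<longleftrightarrow> e \<in> D \<and> addable (D - {e}) e"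

lemma removableD:
  assumes "removable D e"
  shows "lower_set D" "e \<in> D" "insert e (D - {e}) = D"
  using assms by (auto simp: removable_def addable_def insert_absorb)

lemma removable_maximal:
  assumes "removable D (a, b)" "(i, j) \<in> D" "a \<le> i" "b \<le> j"
  shows "(i, j) = (a, b)"
proof (rule ccontr)
  assume "(i, j) \<noteq> (a, b)"
  then have "(i, j) \<in> D - {(a, b)}" "lower_set (D - {(a, b)})"
    using assms by (auto simp: removable_def addable_def)
  moreover have "1 \<le> a" "1 \<le> b" using assms(1) addable_pos by (auto simp: removable_def)
  ultimately have "(a, b) \<in> D - {(a, b)}" using lower_setD assms(3,4) by blast
  then show False by simp
qed

lemma removable_lens:
  assumes "removable D (a, b)"
  shows "rowlen D a = b" "collen D b = a"
proof -
  have D: "lower_set D" and ab: "(a, b) \<in> D" using removableD[OF assms] by auto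
  have le: "b \<le> rowlen D a" "a \<le> collen D b" "1 \<le> a" "1 \<le> b"
    using ab in_row_iff[OF D, of a b] in_col_iff[OF D, of a b] by auto
  then have "(a, rowlen D a) \<in> D" "(collen D b, b) \<in> D"
    using in_row_iff[OF D, of a "rowlen D a"] in_col_iff[OF D, of "collen D b" b] by auto
  then show "rowlen D a = b" "collen D b = a"
    using removable_maximal[OF assms, of a "rowlen D a"] removable_maximal[OF assms, of "collen D b" b] le
    by auto
qed

text \<open>One coordinate of the hook walk to a fixed corner at position \<open>a\<close>.  The walk from a cell jumps to a
uniformly chosen other cell of its hook; the probability that it ends in the corner \<open>(a, b)\<close> when
started at \<open>(i, j)\<close> is \<open>walk u a i * walk v b j\<close>, where \<open>u\<close> and \<open>v\<close> are the hook lengths minus one in the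
column and in the row of the corner.\<close>

definition walk :: "(nat \<Rightarrow> real) \<Rightarrow> nat \<Rightarrow> nat \<Rightarrow> real" where
  "walk u a i = (if i < a then 1 / u i * (\<Prod>k\<in>{i<..<a}. 1 + 1 / u k) else if i = a then 1 else 0)"

lemma walk_beyond: "a < i \<Longrightarrow> walk u a i = 0"
  by (simp add: walk_def)

lemma sum_walk:
  assumes "i \<le> a"
  shows "(\<Sum>k\<in>{i..a}. walk u a k) = (\<Prod>k\<in>{i..<a}. 1 + 1 / u k)"
  using assms
proof (induction rule: inc_induct)
  case base
  show ?case by (simp add: walk_def)
next
  case (step m)
  have "{m..a} = insert m {Suc m..a}" "{m..<a} = insert m {Suc m..<a}" "{m<..<a} = {Suc m..<a}"
    using step.hyps by auto
  then show ?case using step by (simp add: walk_def algebra_simps)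
qed

text \<open>The values of \<open>walk\<close> are chosen to make their tail sums telescope; this is the one-dimensional
recursion behind the averaging property \<open>walk_harmonic\<close>.\<close>

lemma sum_walk_above:
  assumes "i < a \<Longrightarrow> u i \<noteq> 0" "u a = 0"
  shows "(\<Sum>k\<in>{Suc i..a}. walk u a k) = u i * walk u a i"
proof -
  consider "i < a" | "i = a" | "a < i" by linarith
  then show ?thesis
  proof cases
    case 1
    then have "{i<..<a} = {Suc i..<a}" by auto
    then show ?thesis using 1 assms sum_walk[of "Suc i" a u] by (simp add: walk_def)
  qed (use assms in \<open>auto simp: walk_def\<close>)
qed

definition row_walk :: "cell set \<Rightarrow> cell \<Rightarrow> nat \<Rightarrow> real" where
  "row_walk D e = walk (\<lambda>i. real (hooklen D (i, snd e)) - 1) (fst e)"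

definition col_walk :: "cell set \<Rightarrow> cell \<Rightarrow> nat \<Rightarrow> real" where
  "col_walk D e = walk (\<lambda>j. real (hooklen D (fst e, j)) - 1) (snd e)"

lemma hooklen_eq:
  "(i, j) \<in> D \<Longrightarrow> lower_set D \<Longrightarrow> real (hooklen D (i, j)) - 1 = real (rowlen D i) - real j + (real (collen D j) - real i)"
  using in_row_iff[of D i j] in_col_iff[of D i j] by (simp add: hooklen_def arm_eq leg_eq of_nat_diff)

text \<open>The function \<open>(i, j) \<mapsto> row_walk D e i * col_walk D e j\<close> has at each cell the average of its values
at the other cells of the hook.  The one-dimensional recursions yield the factors \<open>u i\<close> and \<open>v j\<close> on
the left, and these add up to the hook length minus one because both sides equal
\<open>(rowlen D i - j) + (collen D j - i)\<close>, the row of \<open>e\<close> having length \<open>b\<close> and its column length \<open>a\<close>.\<close>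

lemma walk_harmonic:
  assumes e: "removable D e" and ij: "(i, j) \<in> D"
  shows "(\<Sum>i' | i < i' \<and> (i', j) \<in> D. row_walk D e i' * col_walk D e j) +
         (\<Sum>j' | j < j' \<and> (i, j') \<in> D. row_walk D e i * col_walk D e j') =
         (real (hooklen D (i, j)) - 1) * (row_walk D e i * col_walk D e j)"
proof -
  obtain a b where eab: "e = (a, b)" by (metis surj_pair)
  have D: "lower_set D" and ab: "(a, b) \<in> D" using removableD[OF e] eab by auto
  have pos: "1 \<le> i" "1 \<le> j" using lower_set_pos[OF D ij] by auto
  note lens = removable_lens[OF e[unfolded eab]]
  define u where "u = (\<lambda>i. real (hooklen D (i, b)) - 1)"
  define v where "v = (\<lambda>j. real (hooklen D (a, j)) - 1)"
  have rw: "row_walk D e = walk u a" and cw: "col_walk D e = walk v b"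
    by (simp_all add: row_walk_def col_walk_def u_def v_def eab)
  show ?thesis
  proof (cases "i \<le> a \<and> j \<le> b")
    case False
    then have zero: "row_walk D e i * col_walk D e j = 0"
      "\<And>i'. i < i' \<Longrightarrow> row_walk D e i' * col_walk D e j = 0"
      "\<And>j'. j < j' \<Longrightarrow> row_walk D e i * col_walk D e j' = 0"
      by (auto simp: rw cw walk_beyond)
    have "(\<Sum>i' | i < i' \<and> (i', j) \<in> D. row_walk D e i' * col_walk D e j) = 0"
      by (rule sum.neutral) (use zero(2) in blast)
    moreover have "(\<Sum>j' | j < j' \<and> (i, j') \<in> D. row_walk D e i * col_walk D e j') = 0"
      by (rule sum.neutral) (use zero(3) in blast)
    ultimately show ?thesis using zero(1) by simp
  next
    case True
    have ib: "(i, b) \<in> D" and aj: "(a, j) \<in> D"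
      using True pos lower_setD[OF D ab, of i b] lower_setD[OF D ab, of a j] lower_set_pos[OF D ab] by auto
    have u0: "u a = 0" "v b = 0"
      using hooklen_eq[OF ab D] lens by (simp_all add: u_def v_def)
    have u1: "u i \<noteq> 0" if "i < a"
      using hooklen_eq[OF ib D] lens that in_row_iff[OF D, of i b] ib by (simp add: u_def)
    have v1: "v j \<noteq> 0" if "j < b"
      using hooklen_eq[OF aj D] lens that in_col_iff[OF D, of a j] aj by (simp add: v_def)
    have uv: "u i + v j = real (hooklen D (i, j)) - 1"
      unfolding u_def v_def hooklen_eq[OF ij D] hooklen_eq[OF ib D] hooklen_eq[OF aj D]
      using lens by simp
    have "(\<Sum>i' | i < i' \<and> (i', j) \<in> D. walk u a i' * walk v b j) =
          (\<Sum>i'\<in>{Suc i..a}. walk u a i' * walk v b j)"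
    proof (rule sum.mono_neutral_right)
      show "finite {i'. i < i' \<and> (i', j) \<in> D}"
        by (rule finite_subset[OF _ lower_set_finite_col[OF D, of j]]) auto
      show "{Suc i..a} \<subseteq> {i'. i < i' \<and> (i', j) \<in> D}"
        using pos by (auto intro: lower_setD[OF D aj])
    qed (auto simp: walk_def)
    also have "\<dots> = u i * (walk u a i * walk v b j)"
      using sum_walk_above[of i a u] u0 u1 by (simp add: sum_distrib_right[symmetric])
    finally have 1: "(\<Sum>i' | i < i' \<and> (i', j) \<in> D. walk u a i' * walk v b j) = \<dots>" .
    have "(\<Sum>j' | j < j' \<and> (i, j') \<in> D. walk u a i * walk v b j') =
          (\<Sum>j'\<in>{Suc j..b}. walk u a i * walk v b j')"
    proof (rule sum.mono_neutral_right)
      show "finite {j'. j < j' \<and> (i, j') \<in> D}"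
        by (rule finite_subset[OF _ lower_set_finite_row[OF D, of i]]) auto
      show "{Suc j..b} \<subseteq> {j'. j < j' \<and> (i, j') \<in> D}"
        using pos by (auto intro: lower_setD[OF D ib])
    qed (auto simp: walk_def)
    also have "\<dots> = v j * (walk u a i * walk v b j)"
      using sum_walk_above[of j b v] u0 v1 by (simp add: sum_distrib_left[symmetric])
    finally have 2: "(\<Sum>j' | j < j' \<and> (i, j') \<in> D. walk u a i * walk v b j') = \<dots>" .
    show ?thesis unfolding rw cw 1 2 uv[symmetric] by (simp add: algebra_simps)
  qed
qed

lemma removable_if_hooklen_1:
  assumes D: "lower_set D" and ij: "(i, j) \<in> D" and h: "hooklen D (i, j) = 1"
  shows "removable D (i, j)"
proof -
  have pos: "1 \<le> i" "1 \<le> j" using lower_set_pos[OF D ij] by auto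
  have "rowlen D i \<le> j" "collen D j \<le> i"
    using h by (simp_all add: hooklen_def arm_eq[OF D] leg_eq[OF D])
  then have no: "(i, Suc j) \<notin> D" "(Suc i, j) \<notin> D"
    by (simp_all add: in_row_iff[OF D, of i "Suc j"] in_col_iff[OF D, of "Suc i" j])
  have top: "(i', j') = (i, j)" if "(i', j') \<in> D" "i \<le> i'" "j \<le> j'" for i' j'
  proof (rule ccontr)
    assume "(i', j') \<noteq> (i, j)"
    then have "Suc i \<le> i' \<or> Suc j \<le> j'" using that by auto
    then show False
      using lower_setD[OF D that(1), of "Suc i" j] lower_setD[OF D that(1), of i "Suc j"] that pos no by auto
  qed
  have "lower_set (D - {(i, j)})"
    unfolding lower_set_def
  proof (intro conjI allI impI)
    show "finite (D - {(i, j)})" using lower_set_finite[OF D] by simp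
    show "1 \<le> r" "1 \<le> c" if "(r, c) \<in> D - {(i, j)}" for r c
      using that lower_set_pos[OF D, of r c] by auto
    show "(r', c') \<in> D - {(i, j)}"
      if "(r, c) \<in> D - {(i, j)}" "1 \<le> r'" "r' \<le> r" "1 \<le> c'" "c' \<le> c" for r c r' c'
      using that lower_setD[OF D, of r c r' c'] top[of r c] by auto
  qed
  then show ?thesis using D ij by (simp add: removable_def addable_def insert_absorb)
qed

lemma finite_removable: "lower_set D \<Longrightarrow> finite {e. removable D e}"
  by (rule finite_subset[of _ D]) (auto simp: removable_def lower_set_finite)

text \<open>The hook walk ends in some corner with probability 1: at a corner the sum is 1 because no other corner
lies weakly north-east of it, and elsewhere the averaging property propagates the value 1 from the
cells of the hook, which have a larger coordinate sum.\<close>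

lemma sum_walk_removable:
  assumes D: "lower_set D"
  shows "(i, j) \<in> D \<Longrightarrow> (\<Sum>e | removable D e. row_walk D e i * col_walk D e j) = 1"
proof -
  obtain M where M: "\<And>i j. (i, j) \<in> D \<Longrightarrow> i + j \<le> M"
  proof
    fix i j assume "(i, j) \<in> D"
    then have "i + j \<in> (\<lambda>u. fst u + snd u) ` D" by force
    then show "i + j \<le> Max ((\<lambda>u. fst u + snd u) ` D)" using lower_set_finite[OF D] by simp
  qed
  let ?Q = "\<lambda>i j. \<Sum>e | removable D e. row_walk D e i * col_walk D e j"
  show "(i, j) \<in> D \<Longrightarrow> ?Q i j = 1"
  proof (induction "M - (i + j)" arbitrary: i j rule: less_induct)
    case less
    note ij = less.prems
    have pos: "1 \<le> i" "1 \<le> j" using lower_set_pos[OF D ij] by auto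
    show ?case
    proof (cases "hooklen D (i, j) = 1")
      case True
      then have rem: "removable D (i, j)" using removable_if_hooklen_1 D ij by blast
      have "row_walk D e i * col_walk D e j = (if e = (i, j) then 1 else 0)" if "removable D e" for e
      proof (cases e)
        case (Pair a b)
        have "\<not> (i \<le> a \<and> j \<le> b)" if "e \<noteq> (i, j)"
          using removable_maximal[OF rem, of a b] removableD(2)[OF \<open>removable D e\<close>] that Pair by auto
        then show ?thesis using Pair by (auto simp: row_walk_def col_walk_def walk_def)
      qed
      then have "?Q i j = (\<Sum>e | removable D e. if e = (i, j) then 1 else 0)"
        by (intro sum.cong) auto
      then show ?thesis using rem finite_removable[OF D] by simp
    next
      case False
      have IH1: "?Q i' j = 1" if "i < i'" "(i', j) \<in> D" for i'
        using less.hyps[of i' j] that M[of i' j] by simp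
      have IH2: "?Q i j' = 1" if "j < j'" "(i, j') \<in> D" for j'
        using less.hyps[of i j'] that M[of i j'] by simp
      let ?I = "{i'. i < i' \<and> (i', j) \<in> D}" and ?J = "{j'. j < j' \<and> (i, j') \<in> D}"
      have "(real (hooklen D (i, j)) - 1) * ?Q i j =
        (\<Sum>e | removable D e. (\<Sum>i'\<in>?I. row_walk D e i' * col_walk D e j) +
           (\<Sum>j'\<in>?J. row_walk D e i * col_walk D e j'))"
        unfolding sum_distrib_left
        by (rule sum.cong) (use walk_harmonic[OF _ ij] in auto)
      also have "\<dots> = (\<Sum>i'\<in>?I. ?Q i' j) + (\<Sum>j'\<in>?J. ?Q i j')"
        unfolding sum.distrib by (subst (1 2) sum.swap) simp
      also have "\<dots> = (\<Sum>i'\<in>?I. 1) + (\<Sum>j'\<in>?J. 1)"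
        using IH1 IH2 by (intro arg_cong2[where f = "(+)"] sum.cong) auto
      also have "\<dots> = real (hooklen D (i, j)) - 1"
        by (simp add: hooklen_def arm_def leg_def)
      finally show ?thesis using False by simp
    qed
  qed
qed

text \<open>The total mass of the walks ending in \<open>e\<close>, started once from each cell, factors into a sum over rows
and a sum over columns.  Both telescope into products of \<open>h / (h - 1)\<close> over the cells whose hooks
shrink when \<open>e\<close> is removed.\<close>

lemma sum_cells_walk:
  assumes e: "removable D e"
  shows "(\<Sum>(i, j)\<in>D. row_walk D e i * col_walk D e j) = inv_hooks (D - {e}) / inv_hooks D"
proof -
  obtain a b where [simp]: "e = (a, b)" by (metis surj_pair)
  define E where "E = D - {(a, b)}"
  have D: "lower_set D" and ab: "(a, b) \<in> D" and DE: "D = insert (a, b) E" and add: "addable E (a, b)"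
    using removableD[OF e] e by (auto simp: E_def removable_def)
  have pos: "1 \<le> a" "1 \<le> b" using lower_set_pos[OF D ab] by auto
  let ?u = "\<lambda>i. real (hooklen D (i, b)) - 1" and ?v = "\<lambda>j. real (hooklen D (a, j)) - 1"
  have "(\<Sum>(i, j)\<in>D. row_walk D e i * col_walk D e j) =
        (\<Sum>(i, j)\<in>{1..a} \<times> {1..b}. row_walk D e i * col_walk D e j)"
  proof (rule sum.mono_neutral_right)
    show "finite D" using lower_set_finite[OF D] .
    show "{1..a} \<times> {1..b} \<subseteq> D" by (auto intro: lower_setD[OF D ab])
    show "\<forall>p\<in>D - {1..a} \<times> {1..b}. (case p of (i, j) \<Rightarrow> row_walk D e i * col_walk D e j) = 0"
    proof
      fix p assume p: "p \<in> D - {1..a} \<times> {1..b}"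
      obtain i j where ij: "p = (i, j)" by (metis surj_pair)
      then have "a < i \<or> b < j" using p lower_set_pos[OF D, of i j] by auto
      then show "(case p of (i, j) \<Rightarrow> row_walk D e i * col_walk D e j) = 0"
        by (auto simp: row_walk_def col_walk_def walk_beyond ij)
    qed
  qed
  also have "\<dots> = (\<Sum>i\<in>{1..a}. row_walk D e i) * (\<Sum>j\<in>{1..b}. col_walk D e j)"
    by (simp add: sum_product sum.cartesian_product)
  also have "\<dots> = (\<Prod>i\<in>{1..<a}. 1 + 1 / ?u i) * (\<Prod>j\<in>{1..<b}. 1 + 1 / ?v j)"
    using sum_walk[OF pos(1)] sum_walk[OF pos(2)] by (simp add: row_walk_def col_walk_def)
  also have "(\<Prod>i\<in>{1..<a}. 1 + 1 / ?u i) =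
     (\<Prod>u\<in>col_cells (insert (a, b) E) E. real (hooklen D u) / real (hooklen E u))"
  proof (rule prod.reindex_bij_witness[of _ fst "\<lambda>i. (i, b)"])
    fix i assume i: "i \<in> {1..<a}"
    then have "(i, b) \<in> E" by (simp add: addable_col[OF add])
    then show "real (hooklen D (i, b)) / real (hooklen E (i, b)) = 1 + 1 / ?u i"
      using hooklen_insert[OF add, of "(i, b)"] by (simp add: DE[symmetric] field_simps)
  qed (use addable_notin[OF add] in \<open>auto simp: col_cells_def addable_col[OF add]\<close>)
  also have "(\<Prod>j\<in>{1..<b}. 1 + 1 / ?v j) =
     (\<Prod>u\<in>row_cells (insert (a, b) E) E. real (hooklen D u) / real (hooklen E u))"
  proof (rule prod.reindex_bij_witness[of _ snd "\<lambda>j. (a, j)"])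
    fix j assume j: "j \<in> {1..<b}"
    then have "(a, j) \<in> E" by (simp add: addable_row[OF add])
    then show "real (hooklen D (a, j)) / real (hooklen E (a, j)) = 1 + 1 / ?v j"
      using hooklen_insert[OF add, of "(a, j)"] by (simp add: DE[symmetric] field_simps)
  qed (use addable_notin[OF add] in \<open>auto simp: row_cells_def addable_row[OF add]\<close>)
  also have "(\<Prod>u\<in>col_cells (insert (a, b) E) E. real (hooklen D u) / real (hooklen E u)) *
    (\<Prod>u\<in>row_cells (insert (a, b) E) E. real (hooklen D u) / real (hooklen E u)) =
    1 / (inv_hooks D / inv_hooks E)"
    unfolding DE inv_hooks_ratio[OF add] by (simp add: prod_dividef mult.commute)
  finally show ?thesis by (simp add: E_def)
qed

text \<open>Splitting the walks, started once from each cell, by the corner in which they end yields the recursion that the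
numbers of standard tableaux satisfy after division by factorials.\<close>

lemma sum_removable_inv_hooks:
  assumes D: "lower_set D"
  shows "(\<Sum>e | removable D e. inv_hooks (D - {e})) = real (card D) * inv_hooks D"
proof -
  have "real (card D) = (\<Sum>(i, j)\<in>D. \<Sum>e | removable D e. row_walk D e i * col_walk D e j)"
    using sum_walk_removable[OF D] by (simp add: case_prod_beta)
  also have "\<dots> = (\<Sum>e | removable D e. \<Sum>(i, j)\<in>D. row_walk D e i * col_walk D e j)"
    by (simp add: case_prod_beta sum.swap[of _ _ D])
  also have "\<dots> = (\<Sum>e | removable D e. inv_hooks (D - {e}) / inv_hooks D)"
    using sum_cells_walk by simp
  finally show ?thesis using inv_hooks_pos[of D] by (simp add: sum_divide_distrib[symmetric])
qed

section \<open>Standard tableaux and the hook length formula\<close>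

lemma in_shape_upto_iff: "u \<in> shape_upto T i \<longleftrightarrow> (\<exists>x. T u = Some x \<and> x \<le> i)"
  by (simp add: shape_upto_def)

lemma shape_upto_mono: "i \<le> j \<Longrightarrow> shape_upto T i \<subseteq> shape_upto T j"
  by (auto simp: shape_upto_def)

lemma shape_upto_eq_dom: "(\<And>a. a \<in> ran T \<Longrightarrow> a \<le> i) \<Longrightarrow> shape_upto T i = dom T"
  by (auto simp: shape_upto_def ranI)

text \<open>For distinct entries, rows and columns increase exactly when all the sets of cells with entries at most \<open>i\<close> are shapes.  In
this form the condition is easy to follow through an insertion, which changes these shapes one by one.\<close>

lemma partial_standard_iff:
  "partial_standard T \<longleftrightarrow> finite (dom T) \<and> inj_on T (dom T) \<and> 0 \<notin> ran T \<and>
     (\<forall>i. lower_set (shape_upto T i))"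
proof (intro iffI conjI allI)
  assume ps: "partial_standard T"
  then have dom: "lower_set (dom T)"
    by (simp add: partial_standard_def semistandard_def young_iff_lower_set)
  show "finite (dom T)" using lower_set_finite[OF dom] .
  show "inj_on T (dom T)" "0 \<notin> ran T" using ps by (simp_all add: partial_standard_def semistandard_def)
  have row: "x \<le> y" if "c < c'" "T (r, c) = Some x" "T (r, c') = Some y" for r c c' x y
    using ps that unfolding partial_standard_def semistandard_def by blast
  have col: "x < y" if "r < r'" "T (r, c) = Some x" "T (r', c) = Some y" for r r' c x y
    using ps that unfolding partial_standard_def semistandard_def by blast
  fix i
  show "lower_set (shape_upto T i)"
    unfolding lower_set_def
  proof (intro conjI allI impI)
    show "finite (shape_upto T i)"
      by (rule finite_subset[OF _ lower_set_finite[OF dom]]) (auto simp: shape_upto_def)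
    fix r c assume rc: "(r, c) \<in> shape_upto T i"
    then obtain x where x: "T (r, c) = Some x" "x \<le> i" by (auto simp: shape_upto_def)
    then have rcd: "(r, c) \<in> dom T" by auto
    then show "1 \<le> r" "1 \<le> c" using lower_set_pos[OF dom] by blast+
    fix r' c' assume le: "1 \<le> r'" "r' \<le> r" "1 \<le> c'" "c' \<le> c"
    have "(r', c) \<in> dom T" "(r', c') \<in> dom T"
      using lower_setD[OF dom rcd, of r' c] lower_setD[OF dom rcd, of r' c'] le by auto
    then obtain y z where y: "T (r', c) = Some y" and z: "T (r', c') = Some z" by auto
    have "y \<le> x" using col[of r' r c y x] x y le by (cases "r' = r") auto
    moreover have "z \<le> y" using row[of c' c r' z y] y z le by (cases "c' = c") auto
    ultimately show "(r', c') \<in> shape_upto T i" using z x by (auto simp: shape_upto_def)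
  qed
next
  assume A: "finite (dom T) \<and> inj_on T (dom T) \<and> 0 \<notin> ran T \<and> (\<forall>i. lower_set (shape_upto T i))"
  have inj: "u = v" if "T u = Some x" "T v = Some x" for u v x
    using A that by (metis domI inj_onD)
  have le: "x \<le> y" if "T (r, c) = Some x" "T (r', c') = Some y" "r \<le> r'" "c \<le> c'" for r c r' c' x y
  proof -
    have "(r, c) \<in> shape_upto T x" "(r', c') \<in> shape_upto T y"
      using that by (auto simp: shape_upto_def)
    moreover have "lower_set (shape_upto T x)" "lower_set (shape_upto T y)" using A by auto
    ultimately have "(r, c) \<in> shape_upto T y" using that by (meson lower_set_pos lower_setD)
    then show ?thesis using that by (auto simp: shape_upto_def)
  qed
  have "finite (ran T)" using A finite_ran by blast
  then have "shape_upto T (Max (ran T)) = dom T" by (intro shape_upto_eq_dom) simp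
  then have "lower_set (dom T)" using A by metis
  moreover have "x < y" if "r < r'" "T (r, c) = Some x" "T (r', c) = Some y" for r r' c x y
  proof -
    have "x \<noteq> y" using inj[of "(r, c)" x "(r', c)"] that by auto
    then show ?thesis using le[of r c x r' c y] that by simp
  qed
  ultimately have "semistandard T"
    unfolding semistandard_def using A le by (auto simp: young_iff_lower_set)
  then show "partial_standard T" using A by (simp add: partial_standard_def)
qed

definition tableaux_on :: "nat set \<Rightarrow> tableau set" where
  "tableaux_on A = {T. partial_standard T \<and> ran T = A}"

lemma tableaux_onD:
  assumes "T \<in> tableaux_on A"
  shows "finite (dom T)" "inj_on T (dom T)" "0 \<notin> A" "lower_set (shape_upto T i)" "ran T = A"
    "lower_set (dom T)"
proof -
  have ps: "partial_standard T" and ran: "ran T = A" using assms by (simp_all add: tableaux_on_def)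
  show "finite (dom T)" "inj_on T (dom T)" "0 \<notin> A" "lower_set (shape_upto T i)"
    using ps ran unfolding partial_standard_iff by auto
  show "ran T = A" by fact
  show "lower_set (dom T)"
    using ps by (simp add: partial_standard_def semistandard_def young_iff_lower_set)
qed

lemma tableaux_onI:
  "finite (dom T) \<Longrightarrow> inj_on T (dom T) \<Longrightarrow> 0 \<notin> A \<Longrightarrow> (\<And>i. lower_set (shape_upto T i)) \<Longrightarrow>
   ran T = A \<Longrightarrow> T \<in> tableaux_on A"
  by (auto simp: tableaux_on_def partial_standard_iff)

lemma tableau_entry_unique:
  "T \<in> tableaux_on A \<Longrightarrow> T u = Some x \<Longrightarrow> T v = Some x \<Longrightarrow> u = v"
  using tableaux_onD(2)[of T A] by (metis domI inj_onD)

lemma tableau_entry_in: "T \<in> tableaux_on A \<Longrightarrow> T u = Some x \<Longrightarrow> x \<in> A"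
  by (metis ranI tableaux_onD(5))

lemma SYT_eq: "SYT lam = {T \<in> tableaux_on {1..card lam}. dom T = lam}"
  by (auto simp: SYT_def tableaux_on_def)

lemma ran_upd_new: "x \<notin> dom T \<Longrightarrow> ran (T(x \<mapsto> m)) = insert m (ran T)"
  by (simp add: domIff)

lemma shape_upto_upd_new:
  assumes "x \<notin> dom T"
  shows "shape_upto (T(x \<mapsto> m)) i = (if i < m then shape_upto T i else insert x (shape_upto T i))"
  using assms by (auto simp: shape_upto_def split: if_splits)

lemma inj_on_upd_new:
  assumes "inj_on T (dom T)" "x \<notin> dom T" "m \<notin> ran T"
  shows "inj_on (T(x \<mapsto> m)) (dom (T(x \<mapsto> m)))"
proof (rule inj_onI)
  fix u v assume uv: "u \<in> dom (T(x \<mapsto> m))" "v \<in> dom (T(x \<mapsto> m))" "(T(x \<mapsto> m)) u = (T(x \<mapsto> m)) v"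
  have "T u \<noteq> Some m" for u using assms(3) by (auto simp: ran_def)
  then show "u = v" using uv inj_onD[OF assms(1), of u v]
    by (auto split: if_splits simp: domIff)
qed

lemma tableaux_on_insert:
  assumes T: "T \<in> tableaux_on A" and m: "0 < m" "\<And>a. a \<in> A \<Longrightarrow> a < m" and x: "addable (dom T) x"
  shows "T(x \<mapsto> m) \<in> tableaux_on (insert m A)"
proof (rule tableaux_onI)
  note D = tableaux_onD[OF T]
  have xn: "x \<notin> dom T" using x by (simp add: addable_def)
  have mn: "m \<notin> ran T" using D(5) m by blast
  show "finite (dom (T(x \<mapsto> m)))" using D(1) by simp
  show "0 \<notin> insert m A" using D(3) m by simp
  show "ran (T(x \<mapsto> m)) = insert m A" using ran_upd_new[OF xn] D(5) by simp
  show "inj_on (T(x \<mapsto> m)) (dom (T(x \<mapsto> m)))" by (rule inj_on_upd_new[OF D(2) xn mn])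
  fix i
  have "shape_upto T i = dom T" if "m \<le> i"
    by (rule shape_upto_eq_dom) (use D(5) m that in fastforce)
  then show "lower_set (shape_upto (T(x \<mapsto> m)) i)"
    using D(4) x by (auto simp: shape_upto_upd_new[OF xn] addable_def)
qed

text \<open>Together with \<open>tableaux_on_insert\<close>, this lets a tableau be built up or taken apart at its largest entry,
the pattern of the inductions over the set of entries below.\<close>

lemma tableaux_on_remove:
  assumes T: "T \<in> tableaux_on (insert m A)" and m: "\<And>a. a \<in> A \<Longrightarrow> a < m"
  obtains T0 x where "T0 \<in> tableaux_on A" "addable (dom T0) x" "T = T0(x \<mapsto> m)"
proof -
  note D = tableaux_onD[OF T]
  have "m \<in> ran T" using D(5) by simp
  then obtain x where x: "T x = Some m" by (auto simp: ran_def)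
  define T0 where "T0 = T(x := None)"
  have upd: "T = T0(x \<mapsto> m)" using x by (auto simp: T0_def)
  have dom: "dom T = insert x (dom T0)" "x \<notin> dom T0" using x by (auto simp: T0_def)
  have mT0: "T0 u \<noteq> Some m" for u
    using tableau_entry_unique[OF T x, of u] by (auto simp: T0_def)
  have mA: "m \<notin> A" using m by blast
  have ran: "ran T0 = A"
  proof -
    have "insert m (ran T0) = insert m A" using ran_upd_new[OF dom(2), of m] upd D(5) by simp
    moreover have "m \<notin> ran T0" using mT0 by (auto simp: ran_def)
    ultimately show ?thesis using mA by (metis insert_ident)
  qed
  have dom0: "dom T0 = shape_upto T (m - 1)"
  proof -
    have "T0 u = Some y \<longleftrightarrow> T u = Some y \<and> y < m" for u y
      using m[of y] ran ranI[of T0 u y] x by (auto simp: T0_def)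
    moreover have "0 < m" using D(3) by (metis gr0I insertI1)
    ultimately show ?thesis by (auto simp: shape_upto_def dom_def less_Suc_eq_le Suc_pred')
  qed
  have "T0 \<in> tableaux_on A"
  proof (rule tableaux_onI)
    show "finite (dom T0)" using D(1) dom by simp
    show "0 \<notin> A" using D(3) by simp
    show "ran T0 = A" by fact
    show "inj_on T0 (dom T0)"
      using tableau_entry_unique[OF T] by (auto simp: inj_on_def T0_def split: if_splits)
    fix i
    show "lower_set (shape_upto T0 i)"
    proof (cases "i < m")
      case True
      then have "shape_upto T0 i = shape_upto T i"
        unfolding upd shape_upto_upd_new[OF dom(2)] by simp
      then show ?thesis using D(4) by simp
    next
      case False
      then have "shape_upto T0 i = dom T0" by (intro shape_upto_eq_dom) (use ran m in fastforce)
      then show ?thesis using D(4) dom0 by simp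
    qed
  qed
  moreover have "addable (dom T0) x"
    using D(6) D(4)[of "m - 1"] dom dom0 by (simp add: addable_def)
  ultimately show ?thesis using that upd by blast
qed

lemma upd_new_eqD:
  assumes "T(x \<mapsto> m) = T'(x' \<mapsto> m)" "m \<notin> ran T" "m \<notin> ran T'" "x \<notin> dom T" "x' \<notin> dom T'"
  shows "x = x'" "T = T'"
proof -
  have "T' x \<noteq> Some m" using assms(3) by (auto simp: ran_def)
  then show "x = x'" using fun_cong[OF assms(1), of x] by (auto split: if_splits)
  then have "(T(x \<mapsto> m))(x := None) = (T'(x \<mapsto> m))(x := None)" using assms(1) by simp
  moreover have "T x = None" "T' x = None" using assms(4,5) \<open>x = x'\<close> by auto
  ultimately show "T = T'" by (metis fun_upd_idem fun_upd_upd)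
qed

lemma bij_betw_tableaux_on_insert:
  assumes m: "0 < m" "\<And>a. a \<in> A \<Longrightarrow> a < m"
  shows "bij_betw (\<lambda>(T, x). T(x \<mapsto> m)) (SIGMA T:tableaux_on A. {x. addable (dom T) x})
           (tableaux_on (insert m A))"
  unfolding bij_betw_def
proof
  have mA: "m \<notin> A" using m by blast
  show "inj_on (\<lambda>(T, x). T(x \<mapsto> m)) (SIGMA T:tableaux_on A. {x. addable (dom T) x})"
  proof (rule inj_onI, clarify)
    fix T x T' x'
    assume "T \<in> tableaux_on A" "T' \<in> tableaux_on A" "addable (dom T) x" "addable (dom T') x'"
      and eq: "T(x \<mapsto> m) = T'(x' \<mapsto> m)"
    then have "m \<notin> ran T" "m \<notin> ran T'" "x \<notin> dom T" "x' \<notin> dom T'"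
      using mA tableaux_onD(5) by (auto simp: addable_def)
    from upd_new_eqD[OF eq this] show "T = T' \<and> x = x'" by simp
  qed
  show "(\<lambda>(T, x). T(x \<mapsto> m)) ` (SIGMA T:tableaux_on A. {x. addable (dom T) x}) = tableaux_on (insert m A)"
  proof
    show "(\<lambda>(T, x). T(x \<mapsto> m)) ` (SIGMA T:tableaux_on A. {x. addable (dom T) x}) \<subseteq> tableaux_on (insert m A)"
      using tableaux_on_insert[OF _ m] by auto
    show "tableaux_on (insert m A) \<subseteq> (\<lambda>(T, x). T(x \<mapsto> m)) ` (SIGMA T:tableaux_on A. {x. addable (dom T) x})"
    proof
      fix T assume "T \<in> tableaux_on (insert m A)"
      then obtain T0 x where "T0 \<in> tableaux_on A" "addable (dom T0) x" "T = T0(x \<mapsto> m)"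
        using tableaux_on_remove m by metis
      then show "T \<in> (\<lambda>(T, x). T(x \<mapsto> m)) ` (SIGMA T:tableaux_on A. {x. addable (dom T) x})"
        by (intro image_eqI[of _ _ "(T0, x)"]) auto
    qed
  qed
qed

lemma finite_addable: "finite {x. addable D x}"
proof (rule finite_subset)
  show "{x. addable D x} \<subseteq> {..collen D 1 + 1} \<times> {..rowlen D 1 + 1}"
  proof
    fix x assume "x \<in> {x. addable D x}"
    then obtain r c where rc: "x = (r, c)" and A: "addable D (r, c)" by (cases x) auto
    then have D: "lower_set D" and pos: "1 \<le> r" "1 \<le> c" by (auto simp: addable_iff)
    have "r \<le> collen D 1 + 1"
    proof (cases "r = 1")
      case False
      then have "(r - 1, c) \<in> D" using A by (simp add: addable_iff)
      then have "(r - 1, 1) \<in> D" using lower_setD[OF D, of "r - 1" c "r - 1" 1] pos False by simp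
      then show ?thesis using in_col_iff[OF D, of "r - 1" 1] by auto
    qed simp
    moreover have "c \<le> rowlen D 1 + 1"
    proof (cases "c = 1")
      case False
      then have "(r, c - 1) \<in> D" using A by (simp add: addable_iff)
      then have "(1, c - 1) \<in> D" using lower_setD[OF D, of r "c - 1" 1 "c - 1"] pos False by simp
      then show ?thesis using in_row_iff[OF D, of 1 "c - 1"] by auto
    qed simp
    ultimately show "x \<in> {..collen D 1 + 1} \<times> {..rowlen D 1 + 1}" by (simp add: rc)
  qed
qed simp

lemma tableaux_on_empty: "tableaux_on {} = {Map.empty}"
proof
  show "tableaux_on {} \<subseteq> {Map.empty}"
  proof
    fix T assume "T \<in> tableaux_on {}"
    then have "ran T = {}" by (simp add: tableaux_on_def)
    then have "T u = None" for u by (metis ranI empty_iff not_None_eq)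
    then show "T \<in> {Map.empty}" by (simp add: fun_eq_iff)
  qed
  show "{Map.empty} \<subseteq> tableaux_on {}"
    by (auto intro!: tableaux_onI simp: shape_upto_def lower_set_def)
qed

lemma finite_tableaux_on: "finite A \<Longrightarrow> finite (tableaux_on A)"
proof (induction A rule: finite_linorder_max_induct)
  case empty
  show ?case by (simp add: tableaux_on_empty)
next
  case (insert m A)
  show ?case
  proof (cases "m = 0")
    case True
    then have "tableaux_on (insert m A) = {}" using tableaux_onD(3) by blast
    then show ?thesis by simp
  next
    case False
    have "finite (SIGMA T:tableaux_on A. {x. addable (dom T) x})"
      using insert.IH finite_addable by (rule finite_SigmaI)
    then show ?thesis
      using bij_betw_finite[OF bij_betw_tableaux_on_insert[of m A]] insert.hyps False by simp
  qed
qed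

lemma finite_SYT: "finite (SYT lam)"
  unfolding SYT_eq using finite_tableaux_on by simp

lemma bij_betw_SYT:
  assumes "card lam = Suc n" and "lower_set lam"
  shows "bij_betw (\<lambda>(e, T). T(e \<mapsto> Suc n)) (SIGMA e:{e. removable lam e}. SYT (lam - {e})) (SYT lam)"
proof -
  have fin: "finite lam" using assms lower_set_finite by blast
  have ins: "{1..Suc n} = insert (Suc n) {1..n}" by auto
  have cd: "card (lam - {e}) = n" if "removable lam e" for e
    using that assms(1) fin by (simp add: removable_def)
  show ?thesis
    unfolding bij_betw_def
  proof
    show "inj_on (\<lambda>(e, T). T(e \<mapsto> Suc n)) (SIGMA e:{e. removable lam e}. SYT (lam - {e}))"
    proof (rule inj_onI, clarify)
      fix e T e' T'
      assume e: "removable lam e" "removable lam e'" and T: "T \<in> SYT (lam - {e})" "T' \<in> SYT (lam - {e'})"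
        and eq: "T(e \<mapsto> Suc n) = T'(e' \<mapsto> Suc n)"
      then have "Suc n \<notin> ran T" "Suc n \<notin> ran T'" "e \<notin> dom T" "e' \<notin> dom T'"
        using cd by (auto simp: SYT_def)
      from upd_new_eqD[OF eq this] show "e = e' \<and> T = T'" by simp
    qed
    show "(\<lambda>(e, T). T(e \<mapsto> Suc n)) ` (SIGMA e:{e. removable lam e}. SYT (lam - {e})) = SYT lam"
    proof
      show "(\<lambda>(e, T). T(e \<mapsto> Suc n)) ` (SIGMA e:{e. removable lam e}. SYT (lam - {e})) \<subseteq> SYT lam"
      proof clarify
        fix e T assume e: "removable lam e" and T: "T \<in> SYT (lam - {e})"
        have T': "T \<in> tableaux_on {1..n}" "dom T = lam - {e}" using T cd[OF e] by (auto simp: SYT_eq)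
        have "T(e \<mapsto> Suc n) \<in> tableaux_on {1..Suc n}"
          unfolding ins by (rule tableaux_on_insert[OF T'(1)]) (use e T' in \<open>auto simp: removable_def\<close>)
        then show "T(e \<mapsto> Suc n) \<in> SYT lam"
          using T'(2) removableD(3)[OF e] by (simp add: SYT_eq assms(1) del: fun_upd_apply)
      qed
      show "SYT lam \<subseteq> (\<lambda>(e, T). T(e \<mapsto> Suc n)) ` (SIGMA e:{e. removable lam e}. SYT (lam - {e}))"
      proof
        fix T assume T: "T \<in> SYT lam"
        then have "T \<in> tableaux_on (insert (Suc n) {1..n})"
          unfolding ins[symmetric] by (simp add: SYT_eq assms(1))
        then obtain T0 e where T0: "T0 \<in> tableaux_on {1..n}" "addable (dom T0) e" "T = T0(e \<mapsto> Suc n)"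
          by (rule tableaux_on_remove) auto
        have dom: "lam = insert e (dom T0)" using T T0(3) by (auto simp: SYT_eq)
        then have dom0: "dom T0 = lam - {e}" using addable_notin[OF T0(2)] by auto
        then have e: "removable lam e" using T0(2) dom by (simp add: removable_def)
        have "T0 \<in> SYT (lam - {e})" using T0(1) dom0 cd[OF e] by (simp add: SYT_eq)
        then show "T \<in> (\<lambda>(e, T). T(e \<mapsto> Suc n)) ` (SIGMA e:{e. removable lam e}. SYT (lam - {e}))"
          using e T0(3) by (intro image_eqI[of _ _ "(e, T0)"]) auto
      qed
    qed
  qed
qed

text \<open>Removing the largest entry gives \<open>f\<^sub>\<lambda> = \<Sum>\<^sub>\<mu> f\<^sub>\<mu>\<close>, and \<open>sum_removable_inv_hooks\<close> is the same recursion for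
\<open>n! * inv_hooks\<close>.\<close>

lemma hook_length_formula:
  "lower_set lam \<Longrightarrow> card lam = n \<Longrightarrow> real (num_SYT lam) = fact n * inv_hooks lam"
proof (induction n arbitrary: lam)
  case 0
  then have "lam = {}" using lower_set_finite by auto
  moreover have "SYT {} = {Map.empty}" by (auto simp: SYT_eq tableaux_on_empty)
  ultimately show ?case by (simp add: num_SYT_def inv_hooks_def)
next
  case (Suc n)
  have IH: "real (card (SYT (lam - {e}))) = fact n * inv_hooks (lam - {e})" if "removable lam e" for e
    using that Suc lower_set_finite[OF Suc.prems(1)]
    by (subst num_SYT_def[symmetric]) (auto simp: removable_def addable_def)
  have "real (num_SYT lam) = (\<Sum>e | removable lam e. real (card (SYT (lam - {e}))))"
    unfolding num_SYT_def using bij_betw_same_card[OF bij_betw_SYT[OF Suc.prems(2,1)]]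
    by (simp add: finite_removable[OF Suc.prems(1)] finite_SYT flip: of_nat_sum)
  also have "\<dots> = fact n * (\<Sum>e | removable lam e. inv_hooks (lam - {e}))"
    using IH by (simp add: sum_distrib_left)
  finally show ?case using sum_removable_inv_hooks[OF Suc.prems(1)] Suc.prems(2) by simp
qed

section \<open>Insertion with arbitrary weights\<close>

text \<open>The same product as \<open>path_prob\<close> with the transition weights left as a parameter, so that it serves
both before and after the passage to the limit.\<close>

fun path_weight ::
    "(cell set \<Rightarrow> cell set \<Rightarrow> cell set \<Rightarrow> 'a::comm_ring_1) \<Rightarrow> tableau \<Rightarrow> cell set \<Rightarrow> nat \<Rightarrow> cell set list \<Rightarrow> 'a" where
  "path_weight w T \<mu> z [] = 1"
| "path_weight w T \<mu> z (\<nu> # \<nu>s) =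
     w (shape_upto T z) \<mu> \<nu> *
     (case T (new_cell \<nu> (shape_upto T z)) of
        None \<Rightarrow> 1
      | Some z' \<Rightarrow> path_weight w T (shape_upto T (z' - 1)) z' \<nu>s)"

lemma path_prob_eq_path_weight: "path_prob q t T \<mu> z \<nu>s = path_weight (trans_prob q t) T \<mu> z \<nu>s"
  by (induction \<nu>s arbitrary: \<mu> z) (simp_all split: option.split)

text \<open>The state in the middle of an insertion: \<open>z\<close> is to be placed, \<open>\<mu>\<close> is the source shape of the step
and \<open>S\<close> the tableau built so far.  The value is the total weight of the continuations ending in \<open>T'\<close>.\<close>

definition branch_sum ::
    "(cell set \<Rightarrow> cell set \<Rightarrow> cell set \<Rightarrow> 'a::comm_ring_1) \<Rightarrow> tableau \<Rightarrow> cell set \<Rightarrow> nat \<Rightarrow> tableau \<Rightarrow> tableau \<Rightarrow> 'a" where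
  "branch_sum w T \<mu> z S T' =
     (\<Sum>\<nu>s | ins_path T z \<nu>s \<and> path_result T S z \<nu>s = T'. path_weight w T \<mu> z \<nu>s)"

lemma displaced_greater:
  "x \<notin> shape_upto T z \<Longrightarrow> T x = Some z' \<Longrightarrow> z < z'"
  by (auto simp: shape_upto_def not_le)

lemma ins_path_cons_iff:
  "ins_path T z \<nu>s \<longleftrightarrow> (\<exists>x \<nu>s'. addable (shape_upto T z) x \<and> \<nu>s = insert x (shape_upto T z) # \<nu>s' \<and>
     (case T x of None \<Rightarrow> \<nu>s' = [] | Some z' \<Rightarrow> ins_path T z' \<nu>s'))"
proof
  assume path: "ins_path T z \<nu>s"
  then obtain \<nu> \<nu>s' where \<nu>s: "\<nu>s = \<nu> # \<nu>s'" by (cases \<nu>s) auto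
  then have "\<nu> \<in> up (shape_upto T z)" using path by simp
  then obtain x where x: "addable (shape_upto T z) x" "\<nu> = insert x (shape_upto T z)"
    unfolding up_eq by blast
  then have "case T x of None \<Rightarrow> \<nu>s' = [] | Some z' \<Rightarrow> ins_path T z' \<nu>s'"
    using path \<nu>s addable_notin[OF x(1)] by simp
  with x \<nu>s show "\<exists>x \<nu>s'. addable (shape_upto T z) x \<and> \<nu>s = insert x (shape_upto T z) # \<nu>s' \<and>
     (case T x of None \<Rightarrow> \<nu>s' = [] | Some z' \<Rightarrow> ins_path T z' \<nu>s')" by blast
qed (auto simp: up_eq addable_notin)

text \<open>Displaced entries strictly increase, so paths have bounded length; each step has finitely many
choices.  Finiteness matters because a sum over an infinite set is 0 by convention.\<close>

lemma finite_ins_path: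
  assumes "finite (ran T)"
  shows "finite {\<nu>s. ins_path T z \<nu>s}"
proof -
  obtain M where M: "\<And>a. a \<in> ran T \<Longrightarrow> a \<le> M" using assms Max_ge by blast
  show ?thesis
  proof (induction "M - z" arbitrary: z rule: less_induct)
    case less
    let ?D = "shape_upto T z"
    let ?tails = "\<lambda>x. case T x of None \<Rightarrow> {[]} | Some z' \<Rightarrow> {\<nu>s. ins_path T z' \<nu>s}"
    have "finite (?tails x)" if "addable ?D x" for x
    proof (cases "T x")
      case (Some z')
      then have "z < z'" "z' \<le> M"
        using displaced_greater[OF addable_notin[OF that]] M[OF ranI] by auto
      then show ?thesis using less.hyps[of z'] Some by simp
    qed simp
    then have "finite (\<Union>x\<in>{x. addable ?D x}. (#) (insert x ?D) ` ?tails x)"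
      using finite_addable by auto
    moreover have "{\<nu>s. ins_path T z \<nu>s} \<subseteq> (\<Union>x\<in>{x. addable ?D x}. (#) (insert x ?D) ` ?tails x)"
    proof
      fix \<nu>s assume "\<nu>s \<in> {\<nu>s. ins_path T z \<nu>s}"
      then obtain x \<nu>s' where "addable ?D x" "\<nu>s = insert x ?D # \<nu>s'"
        "case T x of None \<Rightarrow> \<nu>s' = [] | Some z' \<Rightarrow> ins_path T z' \<nu>s'"
        using ins_path_cons_iff[of T z \<nu>s] by auto
      then show "\<nu>s \<in> (\<Union>x\<in>{x. addable ?D x}. (#) (insert x ?D) ` ?tails x)"
        by (intro UN_I[of x]) (auto split: option.splits)
    qed
    ultimately show ?case by (rule rev_finite_subset)
  qed
qed

text \<open>Splitting off the first step of the path.  All further facts about \<open>branch_sum\<close> come from this recursion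
by induction on the distance of \<open>z\<close> from the largest entry.\<close>

lemma branch_sum_rec:
  assumes "finite (ran T)"
  shows "branch_sum w T \<mu> z S T' =
    (\<Sum>x | addable (shape_upto T z) x. w (shape_upto T z) \<mu> (insert x (shape_upto T z)) *
       (case T x of None \<Rightarrow> if S(x \<mapsto> z) = T' then 1 else 0
        | Some z' \<Rightarrow> branch_sum w T (shape_upto T (z' - 1)) z' (S(x \<mapsto> z)) T'))"
proof -
  let ?D = "shape_upto T z"
  let ?tails = "\<lambda>x. case T x of None \<Rightarrow> if S(x \<mapsto> z) = T' then {[]} else {}
    | Some z' \<Rightarrow> {\<nu>s. ins_path T z' \<nu>s \<and> path_result T (S(x \<mapsto> z)) z' \<nu>s = T'}"
  let ?f = "\<lambda>(x, \<nu>s). insert x ?D # \<nu>s"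
  have fin: "finite (?tails x)" for x
    using finite_ins_path[OF assms] by (auto split: option.split)
  have inj: "inj_on ?f (SIGMA x:{x. addable ?D x}. ?tails x)"
    using inj_on_insert_addable[of ?D] by (auto simp: inj_on_def)
  have "{\<nu>s. ins_path T z \<nu>s \<and> path_result T S z \<nu>s = T'} = ?f ` (SIGMA x:{x. addable ?D x}. ?tails x)"
  proof (intro set_eqI iffI)
    fix \<nu>s assume "\<nu>s \<in> {\<nu>s. ins_path T z \<nu>s \<and> path_result T S z \<nu>s = T'}"
    then obtain x \<nu>s' where x: "addable ?D x" "\<nu>s = insert x ?D # \<nu>s'"
        "case T x of None \<Rightarrow> \<nu>s' = [] | Some z' \<Rightarrow> ins_path T z' \<nu>s'" and T': "path_result T S z \<nu>s = T'"
      using ins_path_cons_iff[of T z \<nu>s] by auto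
    then have "\<nu>s' \<in> ?tails x"
      by (auto simp: addable_notin Let_def split: option.splits)
    then show "\<nu>s \<in> ?f ` (SIGMA x:{x. addable ?D x}. ?tails x)"
      using x by (intro image_eqI[of _ _ "(x, \<nu>s')"]) auto
  next
    fix \<nu>s assume "\<nu>s \<in> ?f ` (SIGMA x:{x. addable ?D x}. ?tails x)"
    then obtain x \<nu>s' where "addable ?D x" "\<nu>s' \<in> ?tails x" "\<nu>s = insert x ?D # \<nu>s'" by auto
    then show "\<nu>s \<in> {\<nu>s. ins_path T z \<nu>s \<and> path_result T S z \<nu>s = T'}"
      by (auto simp: addable_notin up_eq Let_def split: option.splits if_splits)
  qed
  then have "branch_sum w T \<mu> z S T' = (\<Sum>p\<in>(SIGMA x:{x. addable ?D x}. ?tails x). path_weight w T \<mu> z (?f p))"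
    unfolding branch_sum_def by (simp add: sum.reindex[OF inj])
  also have "\<dots> = (\<Sum>x | addable ?D x. \<Sum>\<nu>s\<in>?tails x. path_weight w T \<mu> z (?f (x, \<nu>s)))"
    by (subst sum.Sigma) (use fin finite_addable in \<open>simp_all add: split_def del: path_weight.simps\<close>)
  also have "\<dots> = (\<Sum>x | addable ?D x. w ?D \<mu> (insert x ?D) *
       (case T x of None \<Rightarrow> if S(x \<mapsto> z) = T' then 1 else 0
        | Some z' \<Rightarrow> branch_sum w T (shape_upto T (z' - 1)) z' (S(x \<mapsto> z)) T'))"
    by (rule sum.cong[OF refl])
      (auto simp: addable_notin branch_sum_def sum_distrib_left split: option.split)
  finally show ?thesis .
qed

lemma shape_upto_entry:
  assumes T: "T \<in> tableaux_on A" and x: "T x = Some z"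
  shows "addable (shape_upto T (z - 1)) x" "shape_upto T z = insert x (shape_upto T (z - 1))"
proof -
  have z: "0 < z" using tableaux_onD(3)[OF T] tableau_entry_in[OF T x] by (metis gr0I)
  show eq: "shape_upto T z = insert x (shape_upto T (z - 1))"
  proof (rule set_eqI)
    fix u
    have "T u = Some z \<longleftrightarrow> u = x" using x tableau_entry_unique[OF T] by blast
    moreover have "y \<le> z \<longleftrightarrow> y \<le> z - 1 \<or> y = z" for y using z by auto
    ultimately show "u \<in> shape_upto T z \<longleftrightarrow> u \<in> insert x (shape_upto T (z - 1))"
      unfolding shape_upto_def by auto
  qed
  show "addable (shape_upto T (z - 1)) x"
    using tableaux_onD(4)[OF T, of z] tableaux_onD(4)[OF T, of "z - 1"] x z eq
    by (auto simp: addable_def in_shape_upto_iff)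
qed

text \<open>A sum over paths is a polynomial in the step weights.  Along the paths only weights with
source \<open>D\<close> itself or a shape covered by \<open>D\<close> occur, and only for these a limit is asked.\<close>

lemma tendsto_branch_sum:
  assumes T: "T \<in> tableaux_on A" and A: "finite A"
    and w: "\<And>D \<mu> x. addable D x \<Longrightarrow> \<mu> = D \<or> \<mu> \<lessdot> D \<Longrightarrow> ((\<lambda>t. w t D \<mu> (insert x D)) \<longlongrightarrow> (w' D \<mu> (insert x D) :: real)) F"
  shows "\<mu> = shape_upto T z \<or> \<mu> \<lessdot> shape_upto T z \<Longrightarrow>
    ((\<lambda>t. branch_sum (w t) T \<mu> z S T') \<longlongrightarrow> branch_sum w' T \<mu> z S T') F"
proof -
  have fin: "finite (ran T)" using A tableaux_onD(5)[OF T] by simp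
  obtain M where M: "\<And>a. a \<in> ran T \<Longrightarrow> a \<le> M" using fin Max_ge by blast
  show "\<mu> = shape_upto T z \<or> \<mu> \<lessdot> shape_upto T z \<Longrightarrow>
    ((\<lambda>t. branch_sum (w t) T \<mu> z S T') \<longlongrightarrow> branch_sum w' T \<mu> z S T') F"
  proof (induction "M - z" arbitrary: z \<mu> S rule: less_induct)
    case less
    show ?case
      unfolding branch_sum_rec[OF fin, of _ \<mu> z]
    proof (intro tendsto_sum tendsto_mult)
      fix x assume "x \<in> {x. addable (shape_upto T z) x}"
      then have x: "addable (shape_upto T z) x" by simp
      show "((\<lambda>t. w t (shape_upto T z) \<mu> (insert x (shape_upto T z))) \<longlongrightarrow>
        w' (shape_upto T z) \<mu> (insert x (shape_upto T z))) F"
        using w[OF x less.prems] .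
      show "((\<lambda>t. case T x of None \<Rightarrow> if S(x \<mapsto> z) = T' then 1 else 0
          | Some z' \<Rightarrow> branch_sum (w t) T (shape_upto T (z' - 1)) z' (S(x \<mapsto> z)) T') \<longlongrightarrow>
         (case T x of None \<Rightarrow> if S(x \<mapsto> z) = T' then 1 else 0
          | Some z' \<Rightarrow> branch_sum w' T (shape_upto T (z' - 1)) z' (S(x \<mapsto> z)) T')) F"
      proof (cases "T x")
        case (Some z')
        then have "z < z'" "z' \<le> M" using displaced_greater[OF addable_notin[OF x]] M[OF ranI] by auto
        moreover have "shape_upto T (z' - 1) \<lessdot> shape_upto T z'"
          using covered_by_insert[OF shape_upto_entry(1)[OF T Some]] shape_upto_entry(2)[OF T Some] by simp
        ultimately show ?thesis using less.hyps[of z'] Some by simp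
      qed simp
    qed
  qed
qed

text \<open>The effect of a largest entry \<open>m\<close>, located at \<open>x\<close>: the paths in \<open>T\<close> are those in \<open>T0\<close>, except that a
path ending in the cell \<open>x\<close> displaces \<open>m\<close> and is prolonged by one step from the full shape of \<open>T\<close>.  Whether
a path ends in \<open>x\<close> can be read off its result \<open>T'0\<close>, so the extra factor \<open>K\<close> depends on the result only.\<close>

lemma branch_sum_extend:
  fixes w :: "cell set \<Rightarrow> cell set \<Rightarrow> cell set \<Rightarrow> 'a::comm_ring_1"
  assumes T0: "T0 \<in> tableaux_on A" and A: "finite A" "\<And>a. a \<in> A \<Longrightarrow> a < m" and m: "0 < m"
    and x: "addable (dom T0) x"
    and T'0: "y \<notin> dom T'0" "m \<notin> ran T'0"
  defines "T \<equiv> T0(x \<mapsto> m)"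
  defines "K \<equiv> (if T'0 x = None then if y = x then 1 else 0
    else if addable (dom T) y then w (dom T) (dom T0) (insert y (dom T)) else 0)"
  shows "z < m \<Longrightarrow> dom S \<subseteq> dom T0 \<Longrightarrow> m \<notin> ran S \<Longrightarrow>
    branch_sum w T \<mu> z (S(x \<mapsto> m)) (T'0(y \<mapsto> m)) = branch_sum w T0 \<mu> z S T'0 * K"
proof (induction "m - z" arbitrary: z \<mu> S rule: less_induct)
  case less
  have xT0: "x \<notin> dom T0" "T0 x = None" using x by (auto simp: addable_def)
  have T: "T \<in> tableaux_on (insert m A)"
    unfolding T_def using tableaux_on_insert[OF T0 m A(2) x] .
  have fT0: "finite (ran T0)" and fT: "finite (ran T)"
    using A(1) tableaux_onD(5)[OF T0] tableaux_onD(5)[OF T] by simp_all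
  have sh: "shape_upto T i = shape_upto T0 i" if "i < m" for i
    using shape_upto_upd_new[OF xT0(1), of m i] that by (simp add: T_def)
  have domT0: "shape_upto T (m - 1) = dom T0"
    unfolding sh[OF diff_less[OF zero_less_one m]]
    by (rule shape_upto_eq_dom) (use A(2) tableaux_onD(5)[OF T0] in fastforce)
  have domT: "shape_upto T m = dom T"
    by (rule shape_upto_eq_dom) (use A(2) tableaux_onD(5)[OF T] in fastforce)
  let ?D = "shape_upto T0 z"
  show ?case
    unfolding branch_sum_rec[OF fT, of w \<mu> z] branch_sum_rec[OF fT0, of w \<mu> z] sh[OF less.prems(1)]
      sum_distrib_right
  proof (rule sum.cong[OF refl])
    fix u assume "u \<in> {u. addable ?D u}"
    then have u: "addable ?D u" by simp
    have un: "u \<notin> ?D" using u by (rule addable_notin)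
    let ?L = "case T u of None \<Rightarrow> if S(x \<mapsto> m, u \<mapsto> z) = T'0(y \<mapsto> m) then 1 else 0
         | Some z' \<Rightarrow> branch_sum w T (shape_upto T (z' - 1)) z' (S(x \<mapsto> m, u \<mapsto> z)) (T'0(y \<mapsto> m))"
    let ?R = "case T0 u of None \<Rightarrow> if S(u \<mapsto> z) = T'0 then 1 else 0
         | Some z' \<Rightarrow> branch_sum w T0 (shape_upto T0 (z' - 1)) z' (S(u \<mapsto> z)) T'0"
    have mS: "m \<notin> ran (S(u \<mapsto> z))" using less.prems by (auto simp: ran_def)
    have "?L = ?R * K"
    proof (cases "u = x")
      case True
      \<comment> \<open>\<open>z\<close> takes the cell of \<open>m\<close>, and \<open>m\<close> moves to some cell \<open>v\<close> at the border of \<open>T\<close>\<close>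
      have "branch_sum w T (dom T0) m (S(x \<mapsto> z)) (T'0(y \<mapsto> m)) =
        (\<Sum>v | addable (dom T) v. w (dom T) (dom T0) (insert v (dom T)) *
          (if v = y \<and> S(x \<mapsto> z) = T'0 then 1 else 0))"
        unfolding branch_sum_rec[OF fT, of w "dom T0" m] domT
      proof (rule sum.cong[OF refl])
        fix v assume "v \<in> {v. addable (dom T) v}"
        then have vT: "v \<notin> dom T" using addable_notin by blast
        then have v: "v \<notin> dom (S(x \<mapsto> z))" using less.prems(2) by (auto simp: T_def)
        have "S(x \<mapsto> z, v \<mapsto> m) = T'0(y \<mapsto> m) \<longleftrightarrow> v = y \<and> S(x \<mapsto> z) = T'0"
          using upd_new_eqD[OF _ mS[unfolded True] T'0(2) v T'0(1)] by auto
        then show "w (dom T) (dom T0) (insert v (dom T)) *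
          (case T v of None \<Rightarrow> if S(x \<mapsto> z, v \<mapsto> m) = T'0(y \<mapsto> m) then 1 else 0
           | Some z' \<Rightarrow> branch_sum w T (shape_upto T (z' - 1)) z' (S(x \<mapsto> z, v \<mapsto> m)) (T'0(y \<mapsto> m))) =
          w (dom T) (dom T0) (insert v (dom T)) * (if v = y \<and> S(x \<mapsto> z) = T'0 then 1 else 0)"
          using vT by (simp add: domIff)
      qed
      also have "\<dots> = (\<Sum>v | addable (dom T) v. if v = y then
           (if S(x \<mapsto> z) = T'0 then w (dom T) (dom T0) (insert y (dom T)) else 0) else 0)"
        by (rule sum.cong) auto
      also have "\<dots> = (if addable (dom T) y \<and> S(x \<mapsto> z) = T'0 then w (dom T) (dom T0) (insert y (dom T)) else 0)"
        by (simp add: sum.delta finite_addable)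
      also have "\<dots> = (if S(x \<mapsto> z) = T'0 then 1 else 0) * K"
        by (auto simp: K_def)
      finally show ?thesis using True xT0 domT0 by (simp add: T_def)
    next
      case False
      then have Tu: "T u = T0 u" by (simp add: T_def)
      have swap: "S(x \<mapsto> m, u \<mapsto> z) = S(u \<mapsto> z, x \<mapsto> m)" using False by (simp add: fun_upd_twist)
      have xS: "x \<notin> dom (S(u \<mapsto> z))" using less.prems(2) xT0 False by auto
      show ?thesis
      proof (cases "T0 u")
        case None
        have "S(u \<mapsto> z, x \<mapsto> m) = T'0(y \<mapsto> m) \<longleftrightarrow> x = y \<and> S(u \<mapsto> z) = T'0"
          using upd_new_eqD[OF _ mS T'0(2) xS T'0(1)] by auto
        moreover have "T'0 x = None" if "S(u \<mapsto> z) = T'0"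
          using xS that by (auto simp: domIff)
        ultimately show ?thesis unfolding swap Tu None K_def by auto
      next
        case (Some z')
        have z': "z < z'" "z' < m" "z' - 1 < m"
          using displaced_greater[OF un Some] A(2)[OF tableau_entry_in[OF T0 Some]] by auto
        have "dom (S(u \<mapsto> z)) \<subseteq> dom T0" using Some less.prems(2) by auto
        then have "branch_sum w T (shape_upto T0 (z' - 1)) z' (S(u \<mapsto> z, x \<mapsto> m)) (T'0(y \<mapsto> m)) =
           branch_sum w T0 (shape_upto T0 (z' - 1)) z' (S(u \<mapsto> z)) T'0 * K"
          using less.hyps[of z' "S(u \<mapsto> z)"] z' less.prems(1) mS by auto
        then show ?thesis unfolding swap Tu Some by (simp only: sh[OF z'(3)] option.case)
      qed
    qed
    then show "w ?D \<mu> (insert u ?D) * ?L = w ?D \<mu> (insert u ?D) * ?R * K"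
      by (simp add: mult.assoc)
  qed
qed

text \<open>The hypotheses on \<open>S\<close> describe the tableau while \<open>z\<close> is in flight: it agrees with \<open>T\<close> outside the cells
with entries at most \<open>z\<close>, those cells carry entries below \<open>z\<close>, and its entries together with \<open>z\<close> form \<open>B\<close>.
When \<open>z\<close> displaces \<open>z'\<close> from the cell \<open>u\<close>, the shapes at the levels \<open>i\<close> with \<open>z \<le> i < z'\<close> become
those of \<open>T\<close> with \<open>u\<close> added.  They are shapes because \<open>u\<close> is addable at level \<open>z\<close> and remains
so as long as it is empty.\<close>

lemma path_result_tableaux_on:
  assumes T: "T \<in> tableaux_on A" and B: "0 \<notin> B"
  shows "ins_path T z \<nu>s \<Longrightarrow> (\<And>u. u \<notin> shape_upto T z \<Longrightarrow> S u = T u) \<Longrightarrow>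
    (\<And>u. u \<in> shape_upto T z \<Longrightarrow> \<exists>y<z. S u = Some y) \<Longrightarrow> inj_on S (dom S) \<Longrightarrow>
    z \<notin> ran S \<Longrightarrow> insert z (ran S) = B \<Longrightarrow> (\<And>i. i < z \<Longrightarrow> lower_set (shape_upto S i)) \<Longrightarrow>
    path_result T S z \<nu>s \<in> tableaux_on B \<and> dom T \<lessdot> dom (path_result T S z \<nu>s)"
proof (induction \<nu>s arbitrary: z S)
  case Nil
  then show ?case by simp
next
  case (Cons \<nu> \<nu>s)
  note out = Cons.prems(2) and ins = Cons.prems(3) and inj = Cons.prems(4) and zS = Cons.prems(5)
    and B_eq = Cons.prems(6) and low = Cons.prems(7)
  let ?D = "shape_upto T z"
  obtain u where u: "addable ?D u" "\<nu> = insert u ?D"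
    and rest: "case T u of None \<Rightarrow> \<nu>s = [] | Some z' \<Rightarrow> ins_path T z' \<nu>s"
    using Cons.prems(1) ins_path_cons_iff[of T z "\<nu> # \<nu>s"] by auto
  have un: "u \<notin> ?D" using u addable_notin by blast
  then have Su: "S u = T u" by (rule out)
  define S' where "S' = S(u \<mapsto> z)"
  have new: "new_cell \<nu> ?D = u" using u(2) un by simp
  have Sinj: "v = v'" if "S v = Some y" "S v' = Some y" for v v' y
    using inj that by (metis domI inj_onD)
  have zS': "S v \<noteq> Some z" for v using zS ranI[of S v z] by blast
  have domS: "dom S = dom T"
  proof (intro set_eqI)
    fix v show "v \<in> dom S \<longleftrightarrow> v \<in> dom T"
    proof (cases "v \<in> ?D")
      case True
      then obtain y y' where "T v = Some y" "S v = Some y'" using ins[OF True] by (auto simp: in_shape_upto_iff)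
      then show ?thesis by (simp add: domIff)
    qed (simp add: domIff out)
  qed
  have uz: "T u = Some y \<Longrightarrow> z < y" for y using un by (auto simp: in_shape_upto_iff)
  have small: "lower_set (shape_upto S' i)" if "i < z" for i
  proof -
    have "shape_upto S' i = shape_upto S i"
    proof (rule set_eqI)
      fix v show "v \<in> shape_upto S' i \<longleftrightarrow> v \<in> shape_upto S i"
        using that Su by (cases "v = u") (auto simp: in_shape_upto_iff S'_def dest: uz)
    qed
    then show ?thesis using low that by simp
  qed
  have large: "lower_set (shape_upto S' i)" if i: "z \<le> i" "u \<notin> shape_upto T i" for i
  proof -
    have "v \<in> shape_upto S' i \<longleftrightarrow> v \<in> insert u (shape_upto T i)" for v
    proof (cases "v = u")
      case False
      show ?thesis
      proof (cases "v \<in> ?D")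
        case True
        then show ?thesis using ins[OF True] False i shape_upto_mono[OF i(1), of T]
          by (auto simp: in_shape_upto_iff S'_def)
      next
        case F: False
        show ?thesis using out[OF F] False by (simp add: in_shape_upto_iff S'_def)
      qed
    qed (use i in \<open>simp add: in_shape_upto_iff S'_def\<close>)
    then have "shape_upto S' i = insert u (shape_upto T i)" by blast
    moreover have "addable (shape_upto T i) u"
      using addable_mono[OF u(1) shape_upto_mono[OF i(1)] tableaux_onD(4)[OF T] i(2)] .
    ultimately show ?thesis by (simp add: addable_def)
  qed
  show ?case
  proof (cases "T u")
    case None
    then have res: "path_result T S z (\<nu> # \<nu>s) = S'" by (simp add: new Let_def S'_def)
    have uS: "u \<notin> dom S" using None Su by (simp add: domIff)
    have "S' \<in> tableaux_on B"
    proof (rule tableaux_onI)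
      show "finite (dom S')" using domS tableaux_onD(1)[OF T] by (simp add: S'_def)
      show "inj_on S' (dom S')" unfolding S'_def by (rule inj_on_upd_new[OF inj uS zS])
      show "ran S' = B" unfolding S'_def using ran_upd_new[OF uS] B_eq by simp
      fix i show "lower_set (shape_upto S' i)"
        using small large None by (cases "i < z") (auto simp: in_shape_upto_iff)
    qed (use B in simp)
    moreover have "addable (dom T) u"
      by (rule addable_mono[OF u(1) _ tableaux_onD(6)[OF T]]) (use None in \<open>auto simp: shape_upto_def\<close>)
    moreover have "dom S' = insert u (dom T)" using domS by (simp add: S'_def)
    ultimately show ?thesis unfolding res covered_by_iff by blast
  next
    case (Some z')
    have zz': "z < z'" using uz Some by simp
    have res: "path_result T S z (\<nu> # \<nu>s) = path_result T S' z' \<nu>s"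
      using Some by (simp add: new Let_def S'_def)
    show ?thesis
      unfolding res
    proof (rule Cons.IH)
      show "ins_path T z' \<nu>s" using rest Some by simp
      fix v assume v: "v \<notin> shape_upto T z'"
      then have "v \<noteq> u" "v \<notin> ?D" using Some zz' by (auto simp: in_shape_upto_iff)
      then show "S' v = T v" using out by (simp add: S'_def)
    next
      fix v assume v: "v \<in> shape_upto T z'"
      show "\<exists>y<z'. S' v = Some y"
      proof (cases "v = u")
        case True
        then show ?thesis using zz' by (simp add: S'_def)
      next
        case vu: False
        show ?thesis
        proof (cases "v \<in> ?D")
          case True
          then show ?thesis using ins[OF True] vu zz' by (auto simp: S'_def)
        next
          case False
          obtain y where y: "T v = Some y" "y \<le> z'" using v by (auto simp: in_shape_upto_iff)
          then have "y \<noteq> z'" using vu tableau_entry_unique[OF T Some, of v] by auto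
          then show ?thesis using y out[OF False] vu by (simp add: S'_def)
        qed
      qed
    next
      show "inj_on S' (dom S')"
        using Sinj zS' by (auto simp: inj_on_def S'_def split: if_splits)
      have "S' v \<noteq> Some z'" for v
        using Sinj[of u z' v] Su Some zz' by (auto simp: S'_def)
      then show "z' \<notin> ran S'" by (auto simp: ran_def)
      have "ran S' \<subseteq> insert z (ran S)" by (auto simp: ran_def S'_def split: if_splits)
      moreover have "z \<in> ran S'" by (rule ranI[of _ u]) (simp add: S'_def)
      moreover have "ran S \<subseteq> insert z' (ran S')"
      proof
        fix y assume "y \<in> ran S"
        then obtain v where "S v = Some y" by (auto simp: ran_def)
        then show "y \<in> insert z' (ran S')" using Su Some by (cases "v = u") (auto simp: S'_def intro: ranI)
      qed
      moreover have "z' \<in> ran S" using Su Some by (auto intro: ranI)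
      ultimately show "insert z' (ran S') = B" using B_eq by blast
      fix i assume "i < z'"
      then show "lower_set (shape_upto S' i)"
        using small large Some by (cases "i < z") (auto simp: in_shape_upto_iff)
    qed
  qed
qed

lemma insertion_result:
  assumes T: "T \<in> tableaux_on A" and k: "k \<notin> A" "0 < k" and path: "ins_path T k \<nu>s"
  shows "path_result T T k \<nu>s \<in> tableaux_on (insert k A)" "dom T \<lessdot> dom (path_result T T k \<nu>s)"
proof -
  have "path_result T T k \<nu>s \<in> tableaux_on (insert k A) \<and> dom T \<lessdot> dom (path_result T T k \<nu>s)"
  proof (rule path_result_tableaux_on[OF T _ path])
    show "0 \<notin> insert k A" using k tableaux_onD(3)[OF T] by simp
    show "\<exists>y<k. T u = Some y" if u: "u \<in> shape_upto T k" for u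
    proof -
      obtain y where "T u = Some y" "y \<le> k" using u by (auto simp: in_shape_upto_iff)
      moreover have "y \<noteq> k" using k tableau_entry_in[OF T] calculation by blast
      ultimately show ?thesis by auto
    qed
  qed (use T k tableaux_onD[OF T] in auto)
  then show "path_result T T k \<nu>s \<in> tableaux_on (insert k A)" "dom T \<lessdot> dom (path_result T T k \<nu>s)"
    by auto
qed

section \<open>The limiting weights and their balance\<close>

text \<open>The limit of \<open>trans_prob t t\<close> as \<open>t \<rightarrow> 1\<close>, see \<open>tendsto_trans_prob\<close>.\<close>

definition lim_weight :: "cell set \<Rightarrow> cell set \<Rightarrow> cell set \<Rightarrow> real" where
  "lim_weight D \<mu> \<nu> = (if \<mu> = D then inv_hooks \<nu> / inv_hooks D
     else (inv_hooks \<nu> / inv_hooks D) / (inv_hooks D / inv_hooks \<mu>) /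
       (real_of_int (content (new_cell \<nu> D) - content (new_cell D \<mu>)))\<^sup>2)"

text \<open>The quotient is the reciprocal of the difference quotient of \<open>t powi d\<close> at 1.\<close>

lemma tendsto_ratio_power_int:
  assumes "d \<noteq> 0"
  shows "((\<lambda>t::real. (1 - t) / (1 - t powi d)) \<longlongrightarrow> 1 / real_of_int d) (at 1)"
proof -
  have "((\<lambda>t::real. t powi d) has_field_derivative of_int d) (at 1)"
    by (rule derivative_eq_intros | simp)+
  then have "((\<lambda>t::real. (t powi d - 1) / (t - 1)) \<longlongrightarrow> real_of_int d) (at 1)"
    by (simp add: has_field_derivative_iff)
  then have "((\<lambda>t::real. 1 / ((t powi d - 1) / (t - 1))) \<longlongrightarrow> 1 / real_of_int d) (at 1)"
    using assms by (intro tendsto_divide) auto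
  then show ?thesis by (simp add: minus_divide_divide[of "1 - _" "1 - _", symmetric] del: minus_divide_divide)
qed

lemma tendsto_ratio_power:
  assumes "h' \<noteq> 0"
  shows "((\<lambda>t::real. (1 - t ^ h) / (1 - t ^ h')) \<longlongrightarrow> real h / real h') (at 1)"
proof (cases "h = 0")
  case False
  have "((\<lambda>t::real. ((1 - t) / (1 - t powi int h')) / ((1 - t) / (1 - t powi int h))) \<longlongrightarrow>
     (1 / real_of_int (int h')) / (1 / real_of_int (int h))) (at 1)"
    using assms False by (intro tendsto_divide tendsto_ratio_power_int) auto
  moreover have "x / y / (x / z) = z / y" if "x \<noteq> 0" for x y z :: real
    using that by (cases "y = 0"; cases "z = 0") (simp_all add: field_simps)
  then have "\<forall>\<^sub>F t::real in at 1. ((1 - t) / (1 - t powi int h')) / ((1 - t) / (1 - t powi int h)) =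
      (1 - t ^ h) / (1 - t ^ h')"
    by (auto simp: eventually_at_filter)
  ultimately have "((\<lambda>t::real. (1 - t ^ h) / (1 - t ^ h')) \<longlongrightarrow>
     (1 / real_of_int (int h')) / (1 / real_of_int (int h))) (at 1)"
    by (rule Lim_transform_eventually)
  then show ?thesis by simp
qed simp

lemma hook_leg_eq: "hook_leg t t \<kappa> u = 1 - t ^ hooklen \<kappa> u"
  by (simp add: hook_leg_def hooklen_def power_add mult_ac)

lemma hook_arm_eq: "hook_arm t t \<kappa> u = 1 - t ^ hooklen \<kappa> u"
  by (simp add: hook_arm_def hooklen_def power_add mult_ac)

lemma tendsto_alpha:
  assumes "addable D x"
  shows "((\<lambda>t::real. alpha t t (insert x D) D) \<longlongrightarrow> inv_hooks (insert x D) / inv_hooks D) (at 1)"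
  unfolding inv_hooks_ratio[OF assms] alpha_def hook_leg_eq hook_arm_eq
  by (intro tendsto_mult tendsto_prod tendsto_ratio_power) simp_all

lemma tendsto_power_int_1: "((\<lambda>t::real. t powi d) \<longlongrightarrow> 1) (at 1)"
proof -
  have "((\<lambda>t::real. t powi d) \<longlongrightarrow> 1 powi d) (at 1)"
    by (intro tendsto_power_int tendsto_ident_at) simp
  then show ?thesis by simp
qed

lemma tendsto_trans_prob:
  assumes x: "addable D x" and \<mu>: "\<mu> = D \<or> \<mu> \<lessdot> D"
  shows "((\<lambda>t::real. trans_prob t t D \<mu> (insert x D)) \<longlongrightarrow> lim_weight D \<mu> (insert x D)) (at 1)"
proof (cases "\<mu> = D")
  case True
  have "((\<lambda>t::real. t powi (int (fst x) - 1) * alpha t t (insert x D) D) \<longlongrightarrow>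
     1 * (inv_hooks (insert x D) / inv_hooks D)) (at 1)"
    by (intro tendsto_mult tendsto_power_int_1 tendsto_alpha x)
  then show ?thesis by (simp add: trans_prob_def lim_weight_def True addable_notin[OF x])
next
  case False
  then obtain e where e: "addable \<mu> e" "D = insert e \<mu>" using \<mu> by (auto simp: covered_by_iff)
  have nc: "new_cell (insert x D) D = x" "new_cell D \<mu> = e"
    using addable_notin[OF x] addable_notin[OF e(1)] e(2) by simp_all
  define d where "d = content e - content x"
  have d: "d \<noteq> 0" using content_addable_neq_removable[OF e(1), of x] x e(2) by (simp add: d_def)
  have powers: "t powi (int (snd e) - int (snd x)) * t powi (int (fst x) - int (fst e)) = t powi d"
    "t powi (int (snd e) - int (snd x) + 1) * t powi (int (fst x) - int (fst e) - 1) = t powi d"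
    if "t \<noteq> 0" for t :: real
    using that by (simp_all add: d_def content_def algebra_simps flip: power_int_add)
  let ?a = "\<lambda>t::real. t powi (int (fst x) - int (fst e) - 1) * (alpha t t (insert x D) D / alpha t t D \<mu>)"
  have "((\<lambda>t::real. ?a t * (((1 - t) / (1 - t powi d)) * ((1 - t) / (1 - t powi d)))) \<longlongrightarrow>
     1 * ((inv_hooks (insert x D) / inv_hooks D) / (inv_hooks D / inv_hooks \<mu>)) *
       ((1 / real_of_int d) * (1 / real_of_int d))) (at 1)"
    using tendsto_alpha[OF e(1)] inv_hooks_pos[of D] inv_hooks_pos[of \<mu>]
    by (intro tendsto_mult tendsto_divide tendsto_power_int_1 tendsto_alpha[OF x] tendsto_ratio_power_int[OF d])
      (auto simp: e(2))
  moreover have "\<forall>\<^sub>F t::real in at 1. ?a t * (((1 - t) / (1 - t powi d)) * ((1 - t) / (1 - t powi d))) =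
      trans_prob t t D \<mu> (insert x D)"
    using tendsto_imp_eventually_ne[OF tendsto_ident_at[of "1::real" UNIV], of 0, simplified]
  proof eventually_elim
    case (elim t)
    then show ?case by (simp only: trans_prob_def nc Let_def False if_False powers[OF elim] times_divide_times_eq)
  qed
  ultimately have "((\<lambda>t::real. trans_prob t t D \<mu> (insert x D)) \<longlongrightarrow>
     1 * ((inv_hooks (insert x D) / inv_hooks D) / (inv_hooks D / inv_hooks \<mu>)) *
       ((1 / real_of_int d) * (1 / real_of_int d))) (at 1)"
    by (rule Lim_transform_eventually)
  moreover have "(real_of_int (content x - content e))\<^sup>2 = (real_of_int d)\<^sup>2"
    unfolding d_def by (simp add: power2_commute)
  ultimately show ?thesis using False by (simp add: lim_weight_def nc power2_eq_square)
qed

text \<open>Here \<open>D = insert e \<mu>\<close> and \<open>\<nu> = insert y D\<close> are the shapes, without and with the largest entry, of the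
result of an insertion, and \<open>x\<close> is the position of the largest entry before it.  If \<open>x = e\<close>, the largest
entry is displaced and moves to \<open>y\<close>; otherwise it stays, so \<open>x = y\<close>.  The two contributions have ratio
\<open>1/d\<^sup>2\<close> to \<open>1 - 1/d\<^sup>2\<close> by \<open>inv_hooks_two_addable\<close>, and the second is absent exactly when \<open>d\<^sup>2 = 1\<close>.\<close>

lemma local_balance:
  assumes e: "addable \<mu> e" and y: "addable (insert e \<mu>) y"
  shows "(\<Sum>x | addable \<mu> x. inv_hooks (insert x \<mu>) *
      (if x = e then lim_weight (insert e \<mu>) \<mu> (insert y (insert e \<mu>)) else if x = y then 1 else 0)) =
    inv_hooks \<mu> * inv_hooks (insert y (insert e \<mu>)) / inv_hooks (insert e \<mu>)"
proof -
  let ?D = "insert e \<mu>" and ?\<nu> = "insert y (insert e \<mu>)"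
  let ?d2 = "(real_of_int (content y - content e))\<^sup>2"
  have en: "e \<notin> \<mu>" and yn: "y \<notin> ?D" using addable_notin[OF e] addable_notin[OF y] by auto
  have pos: "inv_hooks ?D > 0" by (rule inv_hooks_pos)
  have d: "?d2 > 0" using content_addable_neq_removable[OF e y] by simp
  have w: "lim_weight ?D \<mu> ?\<nu> = inv_hooks ?\<nu> * inv_hooks \<mu> / (inv_hooks ?D)\<^sup>2 / ?d2"
  proof -
    have "\<mu> \<noteq> ?D" using en by auto
    then show ?thesis using en yn by (simp add: lim_weight_def power2_eq_square)
  qed
  have "(\<Sum>x | addable \<mu> x. inv_hooks (insert x \<mu>) *
      (if x = e then lim_weight ?D \<mu> ?\<nu> else if x = y then 1 else 0)) =
    (\<Sum>x | addable \<mu> x. (if x = e then inv_hooks ?D * lim_weight ?D \<mu> ?\<nu> else 0) +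
       (if x = y then inv_hooks (insert y \<mu>) else 0))"
    by (rule sum.cong) (use yn in auto)
  also have "\<dots> = inv_hooks ?D * lim_weight ?D \<mu> ?\<nu> + (if addable \<mu> y then inv_hooks (insert y \<mu>) else 0)"
    using e by (simp add: sum.distrib finite_addable)
  also have "\<dots> = inv_hooks \<mu> * inv_hooks ?\<nu> / inv_hooks ?D"
  proof (cases "addable \<mu> y")
    case True
    have algebra: "G * (N * M / G\<^sup>2 / s) + M * N * (1 - 1 / s) / G = M * N / G"
      if "G > 0" "s > 0" for G M N s :: real
      using that by (simp add: field_simps power2_eq_square)
    have "y \<noteq> e" using yn by auto
    then have "inv_hooks (insert y \<mu>) = inv_hooks \<mu> * inv_hooks ?\<nu> * (1 - 1 / ?d2) / inv_hooks ?D"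
      using inv_hooks_two_addable(1)[OF True e] pos by (simp add: field_simps)
    then show ?thesis using True algebra[OF pos d] by (simp only: w if_True)
  next
    case False
    have "lim_weight ?D \<mu> ?\<nu> = inv_hooks ?\<nu> * inv_hooks \<mu> / (inv_hooks ?D)\<^sup>2"
      unfolding w content_not_addable[OF e y False] by simp
    then show ?thesis using pos False by (simp add: power2_eq_square)
  qed
  finally show ?thesis .
qed

text \<open>A letter exceeding all entries lands at the border of the tableau, so \<open>T'\<close> arises from exactly one \<open>T\<close>,
and the weight of the single step is the quotient of the two values of \<open>inv_hooks\<close>.\<close>

lemma insertion_balance_largest:
  assumes A: "finite A" "\<And>a. a \<in> A \<Longrightarrow> a < k" and T': "T' \<in> tableaux_on (insert k A)"
  shows "(\<Sum>T\<in>tableaux_on A. inv_hooks (dom T) * branch_sum lim_weight T (shape_upto T k) k T T') =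
    inv_hooks (dom T')"
proof -
  obtain T0 y where T0: "T0 \<in> tableaux_on A" "addable (dom T0) y" "T' = T0(y \<mapsto> k)"
    using T' A(2) by (rule tableaux_on_remove)
  have kn: "k \<notin> ran T" if "T \<in> tableaux_on A" for T
    using A(2) tableaux_onD(5)[OF that] by blast
  \<comment> \<open>every path consists of one step, and its end determines \<open>T\<close> and the new cell\<close>
  have "branch_sum lim_weight T (shape_upto T k) k T T' =
     (if T = T0 then lim_weight (dom T0) (dom T0) (insert y (dom T0)) else 0)"
    if T: "T \<in> tableaux_on A" for T
  proof -
    have fin: "finite (ran T)" using A tableaux_onD(5)[OF T] by simp
    have sh: "shape_upto T k = dom T"
      by (rule shape_upto_eq_dom) (use A(2) tableaux_onD(5)[OF T] in fastforce)
    have "branch_sum lim_weight T (dom T) k T T' =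
      (\<Sum>x | addable (dom T) x. if x = y then (if T = T0 then lim_weight (dom T) (dom T) (insert y (dom T)) else 0) else 0)"
      unfolding branch_sum_rec[OF fin, of lim_weight "dom T"] sh
    proof (rule sum.cong[OF refl])
      fix x assume "x \<in> {x. addable (dom T) x}"
      then have x: "x \<notin> dom T" using addable_notin by blast
      have "T(x \<mapsto> k) = T' \<longleftrightarrow> x = y \<and> T = T0"
        unfolding T0(3) using upd_new_eqD[OF _ kn[OF T] kn[OF T0(1)] x addable_notin[OF T0(2)]] by auto
      then show "lim_weight (dom T) (dom T) (insert x (dom T)) *
        (case T x of None \<Rightarrow> if T(x \<mapsto> k) = T' then 1 else 0
         | Some z' \<Rightarrow> branch_sum lim_weight T (shape_upto T (z' - 1)) z' (T(x \<mapsto> k)) T') =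
        (if x = y then (if T = T0 then lim_weight (dom T) (dom T) (insert y (dom T)) else 0) else 0)"
        using x by (simp add: domIff)
    qed
    then show ?thesis using T0(2) by (simp add: sh finite_addable)
  qed
  then have "(\<Sum>T\<in>tableaux_on A. inv_hooks (dom T) * branch_sum lim_weight T (shape_upto T k) k T T') =
    (\<Sum>T\<in>tableaux_on A. if T = T0 then inv_hooks (dom T0) * lim_weight (dom T0) (dom T0) (insert y (dom T0)) else 0)"
    by (intro sum.cong) auto
  also have "\<dots> = inv_hooks (dom T0) * lim_weight (dom T0) (dom T0) (insert y (dom T0))"
    using T0(1) finite_tableaux_on[OF A(1)] by simp
  also have "\<dots> = inv_hooks (dom T')"
    using inv_hooks_pos[of "dom T0"] by (simp add: lim_weight_def T0(3))
  finally show ?thesis .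
qed

text \<open>The tableaux distributed according to \<open>inv_hooks\<close> of their shape stay so distributed under insertion of
any further letter \<open>k\<close>.  In the induction step the sum over \<open>T\<close> is organised by the tableau left after removing
the largest entry \<open>m\<close>; the sum over the position of \<open>m\<close> is \<open>local_balance\<close>, and what remains
is the induction hypothesis.\<close>

lemma insertion_balance:
  assumes "finite A" "0 < k"
  shows "k \<notin> A \<Longrightarrow> T' \<in> tableaux_on (insert k A) \<Longrightarrow>
    (\<Sum>T\<in>tableaux_on A. inv_hooks (dom T) * branch_sum lim_weight T (shape_upto T k) k T T') =
    inv_hooks (dom T')"
  using assms(1)
proof (induction A arbitrary: T' rule: finite_linorder_max_induct)
  case empty
  then show ?case by (intro insertion_balance_largest) auto
next
  case (insert m A)
  show ?case
  proof (cases "m < k")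
    case True
    then show ?thesis using insert.hyps insert.prems by (intro insertion_balance_largest) auto
  next
    case False
    then have km: "k < m" using insert.prems(1) by auto
    then have m: "0 < m" and kA: "k \<notin> A" using insert.prems by auto
    have less: "a < m" if "a \<in> insert k A" for a using that insert.hyps km by auto
    have "T' \<in> tableaux_on (insert m (insert k A))" using insert.prems(2) by (simp add: insert_commute)
    then obtain T'0 y where T'0: "T'0 \<in> tableaux_on (insert k A)" "addable (dom T'0) y" "T' = T'0(y \<mapsto> m)"
      using less by (rule tableaux_on_remove)
    let ?b = "\<lambda>T. branch_sum lim_weight T (shape_upto T k) k T"
    let ?D = "dom T'0"
    have inner: "(\<Sum>x | addable (dom T) x. inv_hooks (dom (T(x \<mapsto> m))) * ?b (T(x \<mapsto> m)) T') =
       inv_hooks (dom T) * ?b T T'0 * (inv_hooks (dom T') / inv_hooks ?D)"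
      if T: "T \<in> tableaux_on A" for T
    proof -
      let ?K = "\<lambda>x. if T'0 x = None then if y = x then 1 else 0
        else if addable (dom (T(x \<mapsto> m))) y
          then lim_weight (dom (T(x \<mapsto> m))) (dom T) (insert y (dom (T(x \<mapsto> m)))) else 0"
      have b: "?b (T(x \<mapsto> m)) T' = ?b T T'0 * ?K x" if x: "addable (dom T) x" for x
      proof -
        have sh: "shape_upto (T(x \<mapsto> m)) k = shape_upto T k"
          using shape_upto_upd_new[OF addable_notin[OF x]] km by simp
        have mT'0: "m \<notin> ran T'0" using less tableaux_onD(5)[OF T'0(1)] by blast
        have mT: "m \<notin> ran T" using less tableaux_onD(5)[OF T] by blast
        have "branch_sum lim_weight (T(x \<mapsto> m)) (shape_upto T k) k (T(x \<mapsto> m)) (T'0(y \<mapsto> m)) =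
            ?b T T'0 * ?K x"
          by (rule branch_sum_extend[OF T insert.hyps(1) _ m x addable_notin[OF T'0(2)] mT'0 km order_refl mT])
            (use less in simp)
        then show ?thesis unfolding T'0(3) sh .
      qed
      show ?thesis
      proof (cases "?b T T'0 = 0")
        case True
        then show ?thesis using b by simp
      next
        case False
        then obtain \<nu>s where \<nu>s: "ins_path T k \<nu>s" "path_result T T k \<nu>s = T'0"
          unfolding branch_sum_def by (metis (mono_tags, lifting) empty_iff mem_Collect_eq sum.neutral)
        \<comment> \<open>a nonzero weight requires an actual path, hence \<open>?D\<close> covers the shape of \<open>T\<close>\<close>
        then have "dom T \<lessdot> ?D"
          using insertion_result(2)[OF T kA assms(2)] by blast
        then obtain e where e: "addable (dom T) e" "?D = insert e (dom T)"
          by (auto simp: covered_by_iff)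
        have "?K x = (if x = e then lim_weight ?D (dom T) (insert y ?D) else if x = y then 1 else 0)"
          if x: "addable (dom T) x" for x
        proof -
          have "T'0 x = None \<longleftrightarrow> x \<noteq> e"
            using e(2) addable_notin[OF x] by (metis domIff insert_iff)
          then show ?thesis using e T'0(2) by auto
        qed
        then have "(\<Sum>x | addable (dom T) x. inv_hooks (dom (T(x \<mapsto> m))) * ?b (T(x \<mapsto> m)) T') =
          (\<Sum>x | addable (dom T) x. ?b T T'0 * (inv_hooks (insert x (dom T)) *
            (if x = e then lim_weight ?D (dom T) (insert y ?D) else if x = y then 1 else 0)))"
          by (intro sum.cong) (simp_all add: b)
        also have "\<dots> = ?b T T'0 * (inv_hooks (dom T) * inv_hooks (insert y ?D) / inv_hooks ?D)"
          unfolding sum_distrib_left[symmetric] e(2)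
          by (subst local_balance) (use e T'0(2) in auto)
        finally show ?thesis by (simp add: T'0(3))
      qed
    qed
    have "(\<Sum>T\<in>tableaux_on (insert m A). inv_hooks (dom T) * ?b T T') =
      (\<Sum>p\<in>(SIGMA T:tableaux_on A. {x. addable (dom T) x}).
         inv_hooks (dom ((\<lambda>(T, x). T(x \<mapsto> m)) p)) * ?b ((\<lambda>(T, x). T(x \<mapsto> m)) p) T')"
      using less by (intro sum.reindex_bij_betw[symmetric] bij_betw_tableaux_on_insert m) auto
    also have "\<dots> = (\<Sum>T\<in>tableaux_on A. \<Sum>x | addable (dom T) x. inv_hooks (dom (T(x \<mapsto> m))) * ?b (T(x \<mapsto> m)) T')"
      by (subst sum.Sigma) (use finite_tableaux_on[OF insert.hyps(1)] finite_addable in \<open>simp_all add: split_def\<close>)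
    also have "\<dots> = (\<Sum>T\<in>tableaux_on A. inv_hooks (dom T) * ?b T T'0) * (inv_hooks (dom T') / inv_hooks ?D)"
      unfolding sum_distrib_right by (intro sum.cong refl inner)
    also have "(\<Sum>T\<in>tableaux_on A. inv_hooks (dom T) * ?b T T'0) = inv_hooks ?D"
      using insert.IH[OF kA T'0(1)] .
    finally show ?thesis using inv_hooks_pos[of ?D] by simp
  qed
qed

section \<open>Words and histories\<close>

lemma insert_prob_eq:
  "insert_prob q t T k T' = branch_sum (trans_prob q t) T (shape_upto T k) k T T'"
  by (simp add: insert_prob_def branch_sum_def path_prob_eq_path_weight)

lemma tendsto_insert_prob:
  assumes "T \<in> tableaux_on A" "finite A"
  shows "((\<lambda>t::real. insert_prob t t T k T') \<longlongrightarrow>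
    branch_sum lim_weight T (shape_upto T k) k T T') (at 1)"
  unfolding insert_prob_eq
  by (rule tendsto_branch_sum[OF assms]) (use tendsto_trans_prob in auto)

lemma histories_tableaux:
  assumes Ts: "Ts \<in> histories w" and w: "distinct w" "0 \<notin> set w"
  shows "i \<le> length w \<Longrightarrow> Ts ! i \<in> tableaux_on (set (take i w))"
    and "i < length w \<Longrightarrow> dom (Ts ! i) \<lessdot> dom (Ts ! Suc i)"
proof -
  have out: "Ts ! Suc i \<in> outcomes (Ts ! i) (w ! i)" if "i < length w" for i
    using Ts that by (simp add: histories_def)
  have step: "Ts ! Suc i \<in> tableaux_on (set (take (Suc i) w)) \<and> dom (Ts ! i) \<lessdot> dom (Ts ! Suc i)"
    if T: "Ts ! i \<in> tableaux_on (set (take i w))" and i: "i < length w" for i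
  proof -
    have k: "w ! i \<notin> set (take i w)" "0 < w ! i"
      using w i by (auto simp: in_set_conv_nth nth_eq_iff_index_eq)
    obtain \<nu>s where \<nu>s: "ins_path (Ts ! i) (w ! i) \<nu>s" "Ts ! Suc i = path_result (Ts ! i) (Ts ! i) (w ! i) \<nu>s"
      using out[OF i] by (auto simp: outcomes_def)
    show ?thesis
      using insertion_result[OF T k \<nu>s(1)] i by (simp add: \<nu>s(2) take_Suc_conv_app_nth)
  qed
  show all: "Ts ! i \<in> tableaux_on (set (take i w))" if "i \<le> length w" for i
    using that
  proof (induction i)
    case 0
    then show ?case using Ts by (simp add: histories_def tableaux_on_empty)
  next
    case (Suc i)
    then show ?case using step[of i] by simp
  qed
  show "i < length w \<Longrightarrow> dom (Ts ! i) \<lessdot> dom (Ts ! Suc i)" using step[OF all] by simp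
qed

lemma finite_histories:
  assumes "distinct w" "0 \<notin> set w"
  shows "finite (histories w)"
proof (rule finite_subset)
  let ?X = "\<Union>i\<le>length w. tableaux_on (set (take i w))"
  show "finite {Ts. set Ts \<subseteq> ?X \<and> length Ts = length w + 1}"
    by (intro finite_lists_length_eq) (simp add: finite_tableaux_on)
  show "histories w \<subseteq> {Ts. set Ts \<subseteq> ?X \<and> length Ts = length w + 1}"
  proof
    fix Ts assume Ts: "Ts \<in> histories w"
    then have len: "length Ts = length w + 1" by (simp add: histories_def)
    have "set Ts \<subseteq> ?X"
    proof
      fix T assume "T \<in> set Ts"
      then obtain i where "i < length Ts" "T = Ts ! i" by (auto simp: in_set_conv_nth)
      then show "T \<in> ?X" using histories_tableaux(1)[OF Ts assms, of i] len by auto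
    qed
    then show "Ts \<in> {Ts. set Ts \<subseteq> ?X \<and> length Ts = length w + 1}" using len by simp
  qed
qed

definition history_prob :: "'a::field \<Rightarrow> 'a \<Rightarrow> nat list \<Rightarrow> tableau list \<Rightarrow> 'a" where
  "history_prob q t w Ts = (\<Prod>i<length w. insert_prob q t (Ts ! i) (w ! i) (Ts ! Suc i))"

text \<open>The probability that \<open>P\<close> is the insertion tableau of \<open>w\<close>, whatever the recording tableau is.\<close>

definition insertion_tableau_prob :: "'a::field \<Rightarrow> 'a \<Rightarrow> nat list \<Rightarrow> tableau \<Rightarrow> 'a" where
  "insertion_tableau_prob q t w P = (\<Sum>Ts | Ts \<in> histories w \<and> Ts ! length w = P. history_prob q t w Ts)"

lemma histories_snoc:
  "Ts \<in> histories (w @ [k]) \<longleftrightarrow>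
    (\<exists>Us T. Ts = Us @ [T] \<and> Us \<in> histories w \<and> T \<in> outcomes (Us ! length w) k)"
proof
  assume Ts: "Ts \<in> histories (w @ [k])"
  then have len: "length Ts = length w + 2" and 0: "Ts ! 0 = Map.empty"
    and out: "\<And>i. i < Suc (length w) \<Longrightarrow> Ts ! Suc i \<in> outcomes (Ts ! i) ((w @ [k]) ! i)"
    by (simp_all add: histories_def)
  obtain Us T where UT: "Ts = Us @ [T]" using len by (cases Ts rule: rev_cases) auto
  then have lenU: "length Us = length w + 1" using len by simp
  have "Us \<in> histories w"
    unfolding histories_def
  proof (intro CollectI conjI allI impI)
    show "length Us = length w + 1" by fact
    show "Us ! 0 = Map.empty" using 0 lenU by (simp add: UT nth_append)
    fix i assume "i < length w"
    then show "Us ! Suc i \<in> outcomes (Us ! i) (w ! i)"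
      using out[of i] lenU by (simp add: UT nth_append)
  qed
  moreover have "T \<in> outcomes (Us ! length w) k"
    using out[of "length w"] lenU by (simp add: UT nth_append)
  ultimately show "\<exists>Us T. Ts = Us @ [T] \<and> Us \<in> histories w \<and> T \<in> outcomes (Us ! length w) k"
    using UT by blast
next
  assume "\<exists>Us T. Ts = Us @ [T] \<and> Us \<in> histories w \<and> T \<in> outcomes (Us ! length w) k"
  then show "Ts \<in> histories (w @ [k])"
    by (auto simp: histories_def nth_append less_Suc_eq)
qed

text \<open>The last insertion depends on the earlier ones only through the current tableau.\<close>

lemma insertion_tableau_prob_snoc:
  fixes q t :: "'a::field"
  assumes w: "distinct w" "0 \<notin> set w"
  shows "insertion_tableau_prob q t (w @ [k]) P =
    (\<Sum>T\<in>tableaux_on (set w). insertion_tableau_prob q t w T * insert_prob q t T k P)"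
proof -
  let ?n = "length w"
  let ?S = "{Us \<in> histories w. P \<in> outcomes (Us ! ?n) k}"
  have len: "length Us = ?n + 1" if "Us \<in> histories w" for Us
    using that by (simp add: histories_def)
  have eq: "{Ts. Ts \<in> histories (w @ [k]) \<and> Ts ! length (w @ [k]) = P} = (\<lambda>Us. Us @ [P]) ` ?S"
    using len by (auto simp: histories_snoc nth_append)
  have prob: "history_prob q t (w @ [k]) (Us @ [P]) = history_prob q t w Us * insert_prob q t (Us ! ?n) k P"
    if "Us \<in> histories w" for Us
    using len[OF that] by (simp add: history_prob_def nth_append)
  have "insertion_tableau_prob q t (w @ [k]) P =
      (\<Sum>Us\<in>?S. history_prob q t w Us * insert_prob q t (Us ! ?n) k P)"
    unfolding insertion_tableau_prob_def eq
    by (subst sum.reindex) (auto simp: inj_on_def prob intro!: sum.cong)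
  also have "\<dots> = (\<Sum>Us\<in>histories w. history_prob q t w Us * insert_prob q t (Us ! ?n) k P)"
  proof (rule sum.mono_neutral_left[OF finite_histories[OF w]])
    show "\<forall>Us\<in>histories w - ?S. history_prob q t w Us * insert_prob q t (Us ! ?n) k P = 0"
    proof
      fix Us assume "Us \<in> histories w - ?S"
      then have "{\<nu>s. ins_path (Us ! ?n) k \<nu>s \<and> path_result (Us ! ?n) (Us ! ?n) k \<nu>s = P} = {}"
        by (auto simp: outcomes_def)
      then show "history_prob q t w Us * insert_prob q t (Us ! ?n) k P = 0"
        by (simp only: insert_prob_def sum.empty mult_zero_right)
    qed
  qed auto
  also have "\<dots> = (\<Sum>T\<in>tableaux_on (set w). \<Sum>Us | Us \<in> histories w \<and> Us ! ?n = T.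
      history_prob q t w Us * insert_prob q t (Us ! ?n) k P)"
  proof (rule sum.group[symmetric])
    show "finite (histories w)" "finite (tableaux_on (set w))"
      using finite_histories[OF w] finite_tableaux_on by auto
    show "(\<lambda>Us. Us ! ?n) ` histories w \<subseteq> tableaux_on (set w)"
      using histories_tableaux(1)[OF _ w, of _ ?n] by auto
  qed
  also have "\<dots> = (\<Sum>T\<in>tableaux_on (set w). insertion_tableau_prob q t w T * insert_prob q t T k P)"
    unfolding insertion_tableau_prob_def sum_distrib_right by (intro sum.cong) auto
  finally show ?thesis .
qed

lemma tendsto_insertion_tableau_prob:
  "distinct w \<Longrightarrow> 0 \<notin> set w \<Longrightarrow> P \<in> tableaux_on (set w) \<Longrightarrow>
   ((\<lambda>t::real. insertion_tableau_prob t t w P) \<longlongrightarrow> inv_hooks (dom P)) (at 1)"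
proof (induction w arbitrary: P rule: rev_induct)
  case Nil
  have "{Ts. Ts \<in> histories [] \<and> Ts ! length ([]::nat list) = P} = {[Map.empty]}"
    using Nil.prems(3) by (auto simp: histories_def tableaux_on_empty length_Suc_conv)
  then show ?case
    using Nil.prems(3) by (simp add: insertion_tableau_prob_def history_prob_def tableaux_on_empty inv_hooks_def)
next
  case (snoc k w)
  have w: "distinct w" "0 \<notin> set w" "k \<notin> set w" "0 < k" using snoc.prems by auto
  have "((\<lambda>t::real. insertion_tableau_prob t t (w @ [k]) P) \<longlongrightarrow>
     (\<Sum>T\<in>tableaux_on (set w). inv_hooks (dom T) * branch_sum lim_weight T (shape_upto T k) k T P)) (at 1)"
    unfolding insertion_tableau_prob_snoc[OF w(1,2)]
    by (intro tendsto_sum tendsto_mult snoc.IH[OF w(1,2)] tendsto_insert_prob[OF _ finite_set])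
  then show ?case
    using insertion_balance[of "set w" k P] w snoc.prems(3) by simp
qed

text \<open>A saturated chain of shapes from the empty one is a standard tableau; with \<open>tableau_eqI\<close> this makes the
recording tableau of a history exist and be unique.\<close>

lemma tableau_of_chain:
  assumes "D 0 = {}"
  shows "(\<And>i. i < n \<Longrightarrow> D i \<lessdot> D (Suc i)) \<Longrightarrow> \<exists>Q\<in>tableaux_on {1..n}. \<forall>i\<le>n. shape_upto Q i = D i"
proof (induction n)
  case 0
  have "shape_upto Map.empty 0 = {}" by (simp add: shape_upto_def)
  then show ?case using assms by (simp add: tableaux_on_empty)
next
  case (Suc n)
  then obtain Q where Q: "Q \<in> tableaux_on {1..n}" "\<forall>i\<le>n. shape_upto Q i = D i"
    using less_SucI by blast
  have ent: "a \<le> n" if "a \<in> ran Q" for a using that tableaux_onD(5)[OF Q(1)] by auto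
  have sh: "shape_upto Q i = dom Q" if "n \<le> i" for i
    by (rule shape_upto_eq_dom) (use ent that in fastforce)
  have dom: "dom Q = D n" using sh[of n] Q(2) by simp
  obtain x where x: "addable (D n) x" "D (Suc n) = insert x (D n)"
    using Suc.prems[of n] by (auto simp: covered_by_iff)
  have xn: "x \<notin> dom Q" using addable_notin[OF x(1)] dom by simp
  have "Q(x \<mapsto> Suc n) \<in> tableaux_on (insert (Suc n) {1..n})"
    by (rule tableaux_on_insert[OF Q(1)]) (use x dom in auto)
  moreover have "insert (Suc n) {1..n} = {1..Suc n}" by auto
  moreover have "\<forall>i\<le>Suc n. shape_upto (Q(x \<mapsto> Suc n)) i = D i"
    using Q(2) x(2) sh[of "Suc n"] dom by (auto simp: shape_upto_upd_new[OF xn] le_Suc_eq)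
  ultimately show ?case by metis
qed

lemma tableau_eqI:
  assumes Q: "Q \<in> tableaux_on {1..n}" and Q': "Q' \<in> tableaux_on {1..n}"
    and eq: "\<And>i. i \<le> n \<Longrightarrow> shape_upto Q i = shape_upto Q' i"
  shows "Q = Q'"
proof -
  have half: "R' u = Some i"
    if R: "R \<in> tableaux_on {1..n}" "R u = Some i" and eq: "\<And>i. i \<le> n \<Longrightarrow> shape_upto R i = shape_upto R' i"
    for R R' u i
  proof -
    have i: "1 \<le> i" "i \<le> n" using tableau_entry_in[OF R] by auto
    then have "u \<in> shape_upto R i" "u \<notin> shape_upto R (i - 1)" using R(2) by (auto simp: in_shape_upto_iff)
    then have "u \<in> shape_upto R' i" "u \<notin> shape_upto R' (i - 1)" using eq[of i] eq[of "i - 1"] i by auto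
    then show ?thesis using i by (auto simp: in_shape_upto_iff)
  qed
  show ?thesis
  proof
    fix u show "Q u = Q' u"
      using half[OF Q _ eq, of u] half[OF Q' _ eq[symmetric], of u]
      by (cases "Q u"; cases "Q' u") auto
  qed
qed

text \<open>Each history ending in \<open>P\<close> is recorded by exactly one \<open>Q\<close>, so summing over \<open>Q\<close> drops the condition
on the shapes.\<close>

lemma sum_qRSt_prob:
  fixes q t :: "'a::field"
  assumes w: "distinct w" "0 \<notin> set w" and P: "dom P = lam" "card lam = length w"
  shows "(\<Sum>Q\<in>SYT lam. qRSt_prob q t w P Q) = insertion_tableau_prob q t w P"
proof -
  let ?n = "length w"
  let ?B = "\<lambda>Q. {Ts. Ts \<in> histories w \<and> Ts ! ?n = P \<and> (\<forall>i\<le>?n. dom (Ts ! i) = shape_upto Q i)}"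
  have SYT: "SYT lam = {Q \<in> tableaux_on {1..?n}. dom Q = lam}" by (simp add: SYT_eq P)
  have "(\<Union>Q\<in>SYT lam. ?B Q) = {Ts. Ts \<in> histories w \<and> Ts ! ?n = P}"
  proof (intro equalityI subsetI)
    fix Ts assume "Ts \<in> {Ts. Ts \<in> histories w \<and> Ts ! ?n = P}"
    then have Ts: "Ts \<in> histories w" "Ts ! ?n = P" by auto
    have "dom (Ts ! 0) = {}" using Ts(1) by (simp add: histories_def)
    then obtain Q where Q: "Q \<in> tableaux_on {1..?n}" "\<forall>i\<le>?n. shape_upto Q i = dom (Ts ! i)"
      using tableau_of_chain[of "\<lambda>i. dom (Ts ! i)" ?n] histories_tableaux(2)[OF Ts(1) w] by blast
    have "shape_upto Q ?n = dom Q"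
      by (rule shape_upto_eq_dom) (use tableaux_onD(5)[OF Q(1)] in auto)
    then have "dom Q = lam" using Q(2) Ts(2) P(1) by simp
    then have "Q \<in> SYT lam" unfolding SYT using Q(1) by blast
    then show "Ts \<in> (\<Union>Q\<in>SYT lam. ?B Q)" using Ts Q(2) by auto
  qed auto
  moreover have "Q = Q'" if "Q \<in> SYT lam" "Q' \<in> SYT lam" "Ts \<in> ?B Q" "Ts \<in> ?B Q'" for Q Q' Ts
    using that by (intro tableau_eqI[of Q ?n Q']) (auto simp: SYT)
  then have "(\<Sum>Q\<in>SYT lam. sum (history_prob q t w) (?B Q)) = sum (history_prob q t w) (\<Union>Q\<in>SYT lam. ?B Q)"
    by (intro sum.UNION_disjoint[symmetric] finite_SYT)
      (use finite_histories[OF w] in \<open>auto intro: finite_subset[of _ "histories w"]\<close>)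
  ultimately show ?thesis
    by (simp add: qRSt_prob_def insertion_tableau_prob_def history_prob_def)
qed

theorem proposition5p2:
  fixes n :: nat and \<sigma> :: "nat \<Rightarrow> nat" and lam :: "cell set" and P :: tableau
  assumes "\<sigma> permutes {1..n}"
    and "young lam" and "card lam = n"
    and "P \<in> SYT lam"
  shows "((\<lambda>t::real. \<Sum>Q\<in>SYT lam. qRSt_prob t t (one_line n \<sigma>) P Q)
           \<longlongrightarrow> real (num_SYT lam) / fact n) (at 1)"
proof -
  let ?w = "one_line n \<sigma>"
  have set: "set ?w = {1..n}"
    using permutes_image[OF assms(1)] by (simp add: one_line_def atLeastLessThanSuc_atLeastAtMost del: upt_Suc)
  have w: "distinct ?w" "0 \<notin> set ?w" "length ?w = n"
    using permutes_inj_on[OF assms(1)] set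
    by (simp_all add: one_line_def distinct_map del: upt_Suc)
  have P: "P \<in> tableaux_on (set ?w)" "dom P = lam"
    using assms(3,4) by (simp_all add: SYT_eq set)
  have "((\<lambda>t::real. \<Sum>Q\<in>SYT lam. qRSt_prob t t ?w P Q) \<longlongrightarrow> inv_hooks lam) (at 1)"
    using tendsto_insertion_tableau_prob[OF w(1,2) P(1)] P(2) assms(3) w
    by (simp add: sum_qRSt_prob)
  moreover have "inv_hooks lam = real (num_SYT lam) / fact n"
    using hook_length_formula[of lam n] assms(2,3) by (simp add: young_iff_lower_set)
  ultimately show ?thesis by simp
qed

end
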